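(* Suppose that the distributions $G_n$ belong to a scale family with $G_n(\mu)=G(\mu/\sigma_n)$, for some distribution $G$ with density function $g(\theta)$. (1) If $g(\theta)=\Theta(\theta^{-\nu-1})$ for some $\nu>0$, and $\sigma_n\sim n^{\rho}$ with $\rho>-(2\nu)^{-1}$, then the critical sparsity level corresponding to $\{G_n\}$ is $$\beta^*(\rho)=\nu\rho+1.$$ (2) If $g(\theta)=\Theta(e^{-\theta})$ and $\sigma_n=r(2\log n)^{-1/2}$ with $r>\sqrt2/(\sqrt2-1)$, then the critical sparsity level is $$\beta^*(r)=\left(1-\frac1r\right)^2.$$ (3) If $g(\theta)=\Theta\left(e^{-\frac{(\theta-\gamma)^2}{2}}\right)$ for some $\gamma\in\mathbb{R}$, and $\sigma_n=r$ with $r>1$, then the critical sparsity level is $$\beta^*(r)=\frac{r^2}{r^2+1}.$$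
   Context: Model. We observe $X_1,\dots,X_n$ where, given $\mu_1,\dots,\mu_n$, the $X_i$ are independent with $X_i\sim N(\mu_i,1)$. Under $H_0^n$, all $\mu_i=0$. Under $H_1^n$ with sparsity parameter $\beta$, the $\mu_i$ are i.i.d. from $(1-\pi_n)\delta_0+\pi_n G_n$ with $\pi_n=n^{-\beta}$, $0<\beta<1$, where $\delta_0$ is the point mass at $0$. $G$ and $G_n$ also denote cumulative distribution functions, and $\sigma_n>0$. Critical sparsity level. $d_{TV}(H_0^n,H_1^n)$ is the total variation distance ($d_{TV}(Q_1,Q_2)=\sup_A|Q_1(A)-Q_2(A)|$) between the laws of $(X_1,\dots,X_n)$ under $H_0^n$ and $H_1^n$. For a fixed sequence $\{G_n\}$ let $\underline{\beta}^*=\sup\{\beta\ge 0:\lim_n d_{TV}(H_0^n,H_1^n)=1\}$ and $\bar\beta^*=\inf\{\beta\le 1:\lim_n d_{TV}(H_0^n,H_1^n)=0\}$, where $H_1^n$ has sparsity parameter $\beta$. When $\underline{\beta}^*=\bar\beta^*$, the common value is denoted $\beta^*$ and called the critical sparsity level corresponding to $\{G_n\}$. Notation. $g=\Theta(h)$ means that $g/h$ is bounded above and below by positive constants for large $\theta$ (a tail condition on $g$); $\sigma_n\sim n^\rho$ means $\sigma_n/n^\rho\to1$.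
   Formalization: Part (1) is stated for ρ ≤ 0, since for ρ > 0 the value νρ+1 exceeds 1, which a critical level cannot; in all parts the left tail g(-θ) is also assumed O of the stated tail (in (3) with its own centre γ'), since a heavier left tail can change the level. *)

theory Defs
  imports "HOL-Probability.Probability"
begin

text \<open>
  The mixture \<open>(1 - p) \<delta>\<^sub>0 + p G\<close> of the point mass at \<open>0\<close> and \<open>G\<close>;
  it is a probability measure for \<open>0 \<le> p \<le> 1\<close>.
\<close>
definition sparse_mixture :: "real \<Rightarrow> real measure \<Rightarrow> real measure" where
  "sparse_mixture p G =
     measure_of UNIV (sets borel)
       (\<lambda>A. ennreal (1 - p) * emeasure (return borel 0) A + ennreal p * emeasure G A)"

definition obs_law :: "nat \<Rightarrow> (nat \<Rightarrow> real) \<Rightarrow> (nat \<Rightarrow> real) measure" where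
  "obs_law n \<mu> = (\<Pi>\<^sub>M i\<in>{1..n}. density lborel (\<lambda>x. ennreal (normal_density (\<mu> i) 1 x)))"

definition H0 :: "nat \<Rightarrow> (nat \<Rightarrow> real) measure" where
  "H0 n = obs_law n (\<lambda>_. 0)"

text \<open>
  The means are drawn i.i.d. from the mixture with weight \<open>n powr (- \<beta>)\<close>, and the
  observations are drawn from \<^const>\<open>obs_law\<close> given the means. The weight is at most
  \<open>1\<close> only for \<open>\<beta> \<ge> 0\<close>, so the definition is meaningful only there (and for \<open>n \<ge> 1\<close>).
\<close>
definition H1 :: "(nat \<Rightarrow> real measure) \<Rightarrow> real \<Rightarrow> nat \<Rightarrow> (nat \<Rightarrow> real) measure" where
  "H1 Gn \<beta> n =
     (\<Pi>\<^sub>M i\<in>{1..n}. sparse_mixture (real n powr (- \<beta>)) (Gn n)) \<bind> obs_law n"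

definition tv_dist :: "'a measure \<Rightarrow> 'a measure \<Rightarrow> real" where
  "tv_dist P Q = (SUP A\<in>sets P. \<bar>measure P A - measure Q A\<bar>)"

text \<open>
  The supremum and infimum are taken in the extended reals, so that they are \<open>-\<infinity>\<close> and
  \<open>\<infinity>\<close>, rather than unspecified, on the empty set. The infimum ranges over \<open>{0..1}\<close>
  because negative \<open>\<beta>\<close> do not give a model.
\<close>
definition lower_critical :: "(nat \<Rightarrow> real measure) \<Rightarrow> ereal" where
  "lower_critical Gn =
     Sup (ereal ` {\<beta>. 0 \<le> \<beta> \<and> (\<lambda>n. tv_dist (H0 n) (H1 Gn \<beta> n)) \<longlonglongrightarrow> 1})"

definition upper_critical :: "(nat \<Rightarrow> real measure) \<Rightarrow> ereal" where
  "upper_critical Gn =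
     Inf (ereal ` {\<beta>. 0 \<le> \<beta> \<and> \<beta> \<le> 1 \<and> (\<lambda>n. tv_dist (H0 n) (H1 Gn \<beta> n)) \<longlonglongrightarrow> 0})"

definition critical_sparsity_level :: "(nat \<Rightarrow> real measure) \<Rightarrow> real \<Rightarrow> bool" where
  "critical_sparsity_level Gn b \<longleftrightarrow> lower_critical Gn = ereal b \<and> upper_critical Gn = ereal b"

end

theory Submission
  imports Defs "HOL-Real_Asymp.Real_Asymp"
begin

text \<open>
  For \<open>\<beta>\<close> below the critical level the test based on the maximum, with threshold
  \<open>t = sqrt (2 ln n)\<close>, separates the hypotheses: under \<open>H0\<close> the maximum exceeds \<open>t\<close> with
  probability at most \<open>1 / t\<close>, and under \<open>H1\<close> a single observation exceeds \<open>t\<close> with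
  probability at least \<open>n powr (- \<beta>) * P(\<mu> > m) * P(Z > t - m)\<close>, where \<open>m\<close> is chosen to
  maximise the product.

  Above it, the likelihood ratio \<open>1 - \<epsilon> + \<epsilon> * \<integral> exp (\<mu> x - \<mu>\<^sup>2 / 2) dG\<^sub>n(\<mu>)\<close> is truncated: the
  contribution of large means at observations \<open>\<bar>x\<bar> > t\<close> is discarded because its mean is
  \<open>o(1 / n)\<close>, and the remainder is handled by the second moment method. For polynomial tails all large
  means are discarded; for exponential and Gaussian tails completing the square bounds their
  contribution to the likelihood ratio by an explicit Gaussian exponential.
\<close>

section \<open>Products and kernels\<close>

text \<open>The three parameter ranges say that the claimed level exceeds 1/2. This is what the
  second moment method needs: means bounded by a fixed \<open>a\<close> contribute a term of order n
  * eps^2 with eps = n^(-beta), which vanishes only for beta > 1/2. The full second moment, an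
  expectation of exp (mu * mu') over two independent draws from G_n, is infinite in all three
  regimes, so truncation is forced. It is cheap because a lower bound on probabilities under H1,
  valid for every event, already controls total variation. The threshold solves n * exp (- t^2 / 2)
  = 1. The critical exponent comes from minimising over m the cost of a mean of size m under G_n
  plus the cost (t - m)^2 / 2 of the noise that lifts the observation to t. In the exponential and
  Gaussian regimes the completed square at x = t yields the same exponent, so the two halves meet.
  The test uses the right tail of g alone; the upper bounds on the distance use a bound on the left
  tail as well.\<close>

lemma density_PiM:
  fixes f :: "'a \<Rightarrow> ennreal"
  assumes I: "finite I" and P: "prob_space P" and f[measurable]: "f \<in> borel_measurable P"
    and Q: "prob_space (density P f)"
  shows "density (\<Pi>\<^sub>M i\<in>I. P) (\<lambda>x. \<Prod>i\<in>I. f (x i)) = (\<Pi>\<^sub>M i\<in>I. density P f)"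
proof -
  interpret P: prob_space P by (rule P)
  interpret Q: prob_space "density P f" by (rule Q)
  interpret PP: product_sigma_finite "\<lambda>_. P" by standard
  interpret QQ: product_sigma_finite "\<lambda>_. density P f" by standard
  have sets_eq: "sets (\<Pi>\<^sub>M i\<in>I. density P f) = sets (\<Pi>\<^sub>M i\<in>I. P)"
    by (intro sets_PiM_cong) auto
  show ?thesis
  proof (rule QQ.PiM_eqI[OF I])
    fix A assume A: "\<And>i. i \<in> I \<Longrightarrow> A i \<in> sets (density P f)"
    then have A'[measurable]: "\<And>i. i \<in> I \<Longrightarrow> A i \<in> sets P" by simp
    have "emeasure (density (\<Pi>\<^sub>M i\<in>I. P) (\<lambda>x. \<Prod>i\<in>I. f (x i))) (Pi\<^sub>E I A)
        = (\<integral>\<^sup>+x. (\<Prod>i\<in>I. f (x i)) * indicator (Pi\<^sub>E I A) x \<partial>(\<Pi>\<^sub>M i\<in>I. P))"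
      by (subst emeasure_density) (use I A' in \<open>auto intro!: sets_PiM_I_finite\<close>)
    also have "\<dots> = (\<integral>\<^sup>+x. (\<Prod>i\<in>I. f (x i) * indicator (A i) (x i)) \<partial>(\<Pi>\<^sub>M i\<in>I. P))"
    proof (intro nn_integral_cong)
      fix x assume "x \<in> space (\<Pi>\<^sub>M i\<in>I. P)"
      then have x: "x \<in> extensional I" by (auto simp: space_PiM PiE_def)
      have "indicator (Pi\<^sub>E I A) x = (\<Prod>i\<in>I. indicator (A i) (x i) :: ennreal)"
        by (cases "x \<in> Pi\<^sub>E I A") (use I x in \<open>auto simp: PiE_def Pi_def indicator_def\<close>)
      then show "(\<Prod>i\<in>I. f (x i)) * indicator (Pi\<^sub>E I A) x
          = (\<Prod>i\<in>I. f (x i) * indicator (A i) (x i))"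
        by (simp add: prod.distrib)
    qed
    also have "\<dots> = (\<Prod>i\<in>I. \<integral>\<^sup>+y. f y * indicator (A i) y \<partial>P)"
      by (rule PP.product_nn_integral_prod[OF I]) measurable
    also have "\<dots> = (\<Prod>i\<in>I. emeasure (density P f) (A i))"
      by (intro prod.cong refl) (simp add: emeasure_density)
    finally show "emeasure (density (\<Pi>\<^sub>M i\<in>I. P) (\<lambda>x. \<Prod>i\<in>I. f (x i))) (Pi\<^sub>E I A)
        = (\<Prod>i\<in>I. emeasure (density P f) (A i))" .
  qed (simp add: sets_eq)
qed

lemma emeasure_PiM_kernel:
  assumes I: "finite I" and K: "K \<in> measurable M (prob_algebra N)"
    and x: "x \<in> space (\<Pi>\<^sub>M i\<in>I. M)" and A: "\<And>i. i \<in> I \<Longrightarrow> A i \<in> sets N"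
  shows "emeasure (\<Pi>\<^sub>M i\<in>I. K (x i)) (Pi\<^sub>E I A) = (\<Prod>i\<in>I. emeasure (K (x i)) (A i))"
proof -
  have x': "\<And>i. i \<in> I \<Longrightarrow> x i \<in> space M" using x by (auto simp: space_PiM)
  have pr: "prob_space (K (x i))" and st: "sets (K (x i)) = sets N" if "i \<in> I" for i
    using measurable_space[OF K x'[OF that]] by (auto simp: space_prob_algebra)
  \<comment> \<open>A product probability space wants a probability measure at every index, but
    \<open>K (x i)\<close> is one only for i in I. Other indices get a point mass, which needs
    \<open>space N\<close> to be non-empty; hence the separate case of empty I.\<close>
  let ?K = "\<lambda>i. if i \<in> I then K (x i) else return N (SOME y. y \<in> space N)"
  show ?thesis
  proof (cases "I = {}")
    case False
    then obtain i where i: "i \<in> I" by auto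
    have ne: "space N \<noteq> {}"
      using prob_space.not_empty[OF pr[OF i]] sets_eq_imp_space_eq[OF st[OF i]] by simp
    have "prob_space (?K i)" for i
      using pr ne by (auto intro!: prob_space_return someI_ex[of "\<lambda>y. y \<in> space N"])
    then interpret product_prob_space ?K I
      by (intro product_prob_spaceI)
    have "(\<Pi>\<^sub>M i\<in>I. K (x i)) = Pi\<^sub>M I ?K" by (intro PiM_cong) auto
    then show ?thesis using emeasure_PiM[OF I, of A] A st by (simp cong: prod.cong)
  qed (simp add: PiM_empty)
qed

text \<open>Boxes are an intersection-stable generator of the product sigma-algebra, and on a box
  the product measure is a finite product of measurable functions of single coordinates.\<close>

lemma measurable_PiM_kernel:
  assumes I: "finite I" and K: "K \<in> measurable M (prob_algebra N)"
  shows "(\<lambda>x. \<Pi>\<^sub>M i\<in>I. K (x i)) \<in> measurable (\<Pi>\<^sub>M i\<in>I. M) (prob_algebra (\<Pi>\<^sub>M i\<in>I. N))"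
proof (rule measurable_prob_algebra_generated)
  let ?G = "{Pi\<^sub>E I A |A. \<forall>i\<in>I. A i \<in> sets N}"
  have sp: "K y \<in> space (prob_algebra N)" if "y \<in> space M" for y
    using measurable_space[OF K that] .
  then have pr: "prob_space (K y)" and st: "sets (K y) = sets N" if "y \<in> space M" for y
    using that by (auto simp: space_prob_algebra)
  show "sets (\<Pi>\<^sub>M i\<in>I. N) = sigma_sets (\<Pi>\<^sub>E i\<in>I. space N) ?G"
    by (subst sets_PiM, subst prod_algebra_eq_finite[OF I]) (auto simp: Pi_iff)
  show "Int_stable ?G" by (rule Int_stable_PiE)
  show "?G \<subseteq> Pow (\<Pi>\<^sub>E i\<in>I. space N)"
    by (auto simp: PiE_def Pi_def dest: sets.sets_into_space)
  fix x assume x: "x \<in> space (\<Pi>\<^sub>M i\<in>I. M)"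
  then have x': "\<And>i. i \<in> I \<Longrightarrow> x i \<in> space M" by (auto simp: space_PiM)
  show "prob_space (\<Pi>\<^sub>M i\<in>I. K (x i))"
    by (intro prob_space_PiM pr x')
  show "sets (\<Pi>\<^sub>M i\<in>I. K (x i)) = sets (\<Pi>\<^sub>M i\<in>I. N)"
    by (intro sets_PiM_cong refl st x')
next
  fix B assume "B \<in> {Pi\<^sub>E I A |A. \<forall>i\<in>I. A i \<in> sets N}"
  then obtain A where B: "B = Pi\<^sub>E I A" and A: "\<And>i. i \<in> I \<Longrightarrow> A i \<in> sets N" by auto
  have K': "K \<in> measurable M (subprob_algebra N)" using K by (rule measurable_prob_algebraD)
  have "emeasure (\<Pi>\<^sub>M i\<in>I. K (x i)) B = (\<Prod>i\<in>I. emeasure (K (x i)) (A i))"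
    if "x \<in> space (\<Pi>\<^sub>M i\<in>I. M)" for x
    unfolding B using A by (rule emeasure_PiM_kernel[OF I K that])
  moreover have "(\<lambda>x. \<Prod>i\<in>I. emeasure (K (x i)) (A i)) \<in> borel_measurable (\<Pi>\<^sub>M i\<in>I. M)"
    by (intro borel_measurable_prod_ennreal
        measurable_compose[OF measurable_component_singleton[where M="\<lambda>_. M"]]
        measurable_emeasure_kernel[OF K'] A)
  ultimately show "(\<lambda>x. emeasure (\<Pi>\<^sub>M i\<in>I. K (x i)) B) \<in> borel_measurable (\<Pi>\<^sub>M i\<in>I. M)"
    by (simp cong: measurable_cong)
qed

text \<open>On a box both sides factor over the coordinates. This collapses the two-stage model of
  means and observations to independent copies of one marginal.\<close>

lemma bind_PiM_kernel:
  assumes I: "finite I" and M: "prob_space M" and K: "K \<in> measurable M (prob_algebra N)"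
  shows "(\<Pi>\<^sub>M i\<in>I. M) \<bind> (\<lambda>x. \<Pi>\<^sub>M i\<in>I. K (x i)) = (\<Pi>\<^sub>M i\<in>I. M \<bind> K)"
proof -
  interpret M: prob_space M by (rule M)
  have K': "K \<in> measurable M (subprob_algebra N)" using K by (rule measurable_prob_algebraD)
  have PK: "(\<lambda>x. \<Pi>\<^sub>M i\<in>I. K (x i)) \<in> measurable (\<Pi>\<^sub>M i\<in>I. M) (subprob_algebra (\<Pi>\<^sub>M i\<in>I. N))"
    using measurable_PiM_kernel[OF I K] by (rule measurable_prob_algebraD)
  have B: "prob_space (M \<bind> K)"
    using prob_space_bind'[OF _ K] M by (simp add: space_prob_algebra)
  have sB: "sets (M \<bind> K) = sets N"
    using sets_bind[OF sets_kernel[OF K'] M.not_empty] .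
  interpret BB: product_sigma_finite "\<lambda>_. M \<bind> K"
    using B by (simp add: product_sigma_finite_def prob_space_imp_sigma_finite)
  interpret MM: product_prob_space "\<lambda>_. M" I by (intro product_prob_spaceI M)
  show ?thesis
  proof (rule BB.PiM_eqI[OF I])
    show "sets ((\<Pi>\<^sub>M i\<in>I. M) \<bind> (\<lambda>x. \<Pi>\<^sub>M i\<in>I. K (x i))) = sets (\<Pi>\<^sub>M i\<in>I. M \<bind> K)"
      using sets_bind[OF sets_kernel[OF PK] MM.P.not_empty]
      by (simp add: sB cong: sets_PiM_cong)
    fix A assume "\<And>i. i \<in> I \<Longrightarrow> A i \<in> sets (M \<bind> K)"
    then have A: "\<And>i. i \<in> I \<Longrightarrow> A i \<in> sets N" by (simp add: sB)
    have "emeasure ((\<Pi>\<^sub>M i\<in>I. M) \<bind> (\<lambda>x. \<Pi>\<^sub>M i\<in>I. K (x i))) (Pi\<^sub>E I A)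
        = (\<integral>\<^sup>+x. emeasure (\<Pi>\<^sub>M i\<in>I. K (x i)) (Pi\<^sub>E I A) \<partial>(\<Pi>\<^sub>M i\<in>I. M))"
      by (rule emeasure_bind[OF MM.P.not_empty PK]) (use A I in \<open>auto intro!: sets_PiM_I_finite\<close>)
    also have "\<dots> = (\<integral>\<^sup>+x. (\<Prod>i\<in>I. emeasure (K (x i)) (A i)) \<partial>(\<Pi>\<^sub>M i\<in>I. M))"
    proof (intro nn_integral_cong)
      fix x assume "x \<in> space (\<Pi>\<^sub>M i\<in>I. M)"
      then show "emeasure (\<Pi>\<^sub>M i\<in>I. K (x i)) (Pi\<^sub>E I A) = (\<Prod>i\<in>I. emeasure (K (x i)) (A i))"
        using A by (intro emeasure_PiM_kernel[OF I K])
    qed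
    also have "\<dots> = (\<Prod>i\<in>I. \<integral>\<^sup>+y. emeasure (K y) (A i) \<partial>M)"
      using A by (intro MM.product_nn_integral_prod[OF I] measurable_emeasure_kernel[OF K'])
    also have "\<dots> = (\<Prod>i\<in>I. emeasure (M \<bind> K) (A i))"
      using A by (intro prod.cong refl emeasure_bind[OF M.not_empty K', symmetric])
    finally show "emeasure ((\<Pi>\<^sub>M i\<in>I. M) \<bind> (\<lambda>x. \<Pi>\<^sub>M i\<in>I. K (x i))) (Pi\<^sub>E I A)
        = (\<Prod>i\<in>I. emeasure (M \<bind> K) (A i))" .
  qed
qed

section \<open>The sparse mixture model\<close>

abbreviation gauss :: "real \<Rightarrow> real measure" where
  "gauss \<mu> \<equiv> density lborel (\<lambda>x. ennreal (normal_density \<mu> 1 x))"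

lemma prob_space_gauss: "prob_space (gauss \<mu>)"
  by (rule prob_space_normal_density) simp

lemma measurable_gauss: "gauss \<in> measurable borel (prob_algebra borel)"
\<comment> \<open>The sigma-algebra serves as its own generator, because joint measurability of the
  density in mean and point handles every Borel set directly.\<close>
proof (rule measurable_prob_algebra_generated[of borel UNIV "sets borel"])
  show "sets borel = sigma_sets UNIV (sets borel :: real set set)"
    using sets.sigma_sets_eq[of "borel :: real measure"] by simp
  show "Int_stable (sets borel :: real set set)" by (auto simp: Int_stable_def)
  fix A :: "real set" assume [measurable]: "A \<in> sets borel"
  have "(\<lambda>\<mu>. \<integral>\<^sup>+x. ennreal (normal_density \<mu> 1 x) * indicator A x \<partial>lborel) \<in> borel_measurable borel"
    unfolding normal_density_def by measurable
  then show "(\<lambda>\<mu>. emeasure (gauss \<mu>) A) \<in> borel_measurable borel"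
    by (subst emeasure_density) auto
qed (auto intro: prob_space_gauss)

context
  fixes p :: real and G :: "real measure"
  assumes p: "0 \<le> p" "p \<le> 1" and G: "real_distribution G"
begin

interpretation G: real_distribution G by (rule G)

lemma sets_sparse_mixture: "sets (sparse_mixture p G) = sets borel"
  using sets.sigma_sets_eq[of "borel :: real measure"] by (simp add: sparse_mixture_def)

text \<open>\<open>measure_of\<close> falls back to the zero measure when the set function is not
  countably additive, so the formula in the definition becomes available only after this
  check.\<close>

lemma emeasure_sparse_mixture:
  assumes "A \<in> sets borel"
  shows "emeasure (sparse_mixture p G) A = ennreal (1 - p) * indicator A 0 + ennreal p * emeasure G A"
proof -
  have "emeasure (sparse_mixture p G) A
      = ennreal (1 - p) * emeasure (return borel 0) A + ennreal p * emeasure G A"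
    unfolding sparse_mixture_def
  proof (rule emeasure_measure_of_sigma)
    show "sigma_algebra UNIV (sets (borel :: real measure))"
      using sets.sigma_algebra_axioms[of "borel :: real measure"] by simp
    show "countably_additive (sets borel) (\<lambda>A. ennreal (1 - p) * emeasure (return borel 0) A + ennreal p * emeasure G A)"
    proof (rule countably_additiveI)
      fix A :: "nat \<Rightarrow> real set"
      assume A: "range A \<subseteq> sets borel" "disjoint_family A"
      then show "(\<Sum>i. ennreal (1 - p) * emeasure (return borel 0) (A i) + ennreal p * emeasure G (A i))
        = ennreal (1 - p) * emeasure (return borel 0) (\<Union>i. A i) + ennreal p * emeasure G (\<Union>i. A i)"
        by (subst suminf_add[symmetric]) (simp_all add: suminf_emeasure del: emeasure_return)
    qed
  qed (auto simp: positive_def assms)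
  then show ?thesis using assms by simp
qed

lemma prob_space_sparse_mixture: "prob_space (sparse_mixture p G)"
proof
  have "space (sparse_mixture p G) = UNIV" by (simp add: sparse_mixture_def)
  then show "emeasure (sparse_mixture p G) (space (sparse_mixture p G)) = 1"
    using p G.emeasure_space_1 by (simp add: emeasure_sparse_mixture flip: ennreal_plus)
qed

lemma nn_integral_sparse_mixture:
  assumes "f \<in> borel_measurable borel"
  shows "(\<integral>\<^sup>+x. f x \<partial>sparse_mixture p G) = ennreal (1 - p) * f 0 + ennreal p * (\<integral>\<^sup>+x. f x \<partial>G)"
  using assms
proof (induction rule: borel_measurable_induct)
  case (cong f g)
  then show ?case by simp
next
  case (set A)
  then show ?case by (simp add: emeasure_sparse_mixture sets_sparse_mixture)
next
  case (mult u c)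
  then show ?case
    by (simp add: nn_integral_cmult sets_sparse_mixture cong: measurable_cong_sets) (simp add: algebra_simps)
next
  case (add u v)
  then show ?case
    by (simp add: nn_integral_add sets_sparse_mixture cong: measurable_cong_sets) (simp add: algebra_simps)
next
  case (seq U)
  have m: "U i \<in> borel_measurable (sparse_mixture p G)" for i
    using seq.hyps(1)[of i] by (simp add: sets_sparse_mixture cong: measurable_cong_sets)
  have m': "U i \<in> borel_measurable G" for i
    using seq.hyps(1)[of i] by simp
  have inc: "incseq (\<lambda>i. \<integral>\<^sup>+x. U i x \<partial>G)" "incseq (\<lambda>i. U i 0)"
    using seq.hyps(3) by (auto simp: incseq_def le_fun_def intro!: nn_integral_mono)
  have "(\<integral>\<^sup>+x. (SUP i. U i) x \<partial>sparse_mixture p G) = (SUP i. \<integral>\<^sup>+x. U i x \<partial>sparse_mixture p G)"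
    using nn_integral_monotone_convergence_SUP[OF seq.hyps(3) m] by (simp add: image_comp)
  also have "\<dots> = (SUP i. ennreal (1 - p) * U i 0 + ennreal p * (\<integral>\<^sup>+x. U i x \<partial>G))"
    using seq.IH by simp
  also have "\<dots> = (SUP i. ennreal (1 - p) * U i 0) + (SUP i. ennreal p * (\<integral>\<^sup>+x. U i x \<partial>G))"
    using inc by (intro ennreal_SUP_add) (auto simp: incseq_def intro!: mult_left_mono)
  also have "\<dots> = ennreal (1 - p) * (SUP i. U i 0) + ennreal p * (SUP i. \<integral>\<^sup>+x. U i x \<partial>G)"
    by (simp add: SUP_mult_left_ennreal)
  also have "(SUP i. \<integral>\<^sup>+x. U i x \<partial>G) = (\<integral>\<^sup>+x. (SUP i. U i) x \<partial>G)"
    using nn_integral_monotone_convergence_SUP[OF seq.hyps(3) m'] by (simp add: image_comp)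
  finally show ?case by (simp add: image_comp)
qed

end

lemma H0_eq: "H0 n = (\<Pi>\<^sub>M i\<in>{1..n}. gauss 0)"
  by (simp add: H0_def obs_law_def)

lemma weight_bounds:
  assumes "0 \<le> \<beta>" "1 \<le> n"
  shows "0 \<le> real n powr - \<beta>" "real n powr - \<beta> \<le> 1"
  using assms powr_mono[of "- \<beta>" 0 "real n"] by auto

text \<open>From here on the alternative is a product of identical marginals, as the null hypothesis
  is, and the analysis reduces to one coordinate.\<close>

lemma H1_eq:
  fixes \<beta> :: real and n :: nat and Gn :: "nat \<Rightarrow> real measure"
  assumes \<beta>: "0 \<le> \<beta>" and n: "1 \<le> n" and Gn: "real_distribution (Gn n)"
  shows "H1 Gn \<beta> n = (\<Pi>\<^sub>M i\<in>{1..n}. sparse_mixture (real n powr - \<beta>) (Gn n) \<bind> gauss)"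
proof -
  have "gauss \<in> measurable (sparse_mixture (real n powr - \<beta>) (Gn n)) (prob_algebra borel)"
    using measurable_gauss measurable_cong_sets[OF sets_sparse_mixture[OF weight_bounds[OF \<beta> n] Gn] refl]
    by blast
  from bind_PiM_kernel[OF _ prob_space_sparse_mixture[OF weight_bounds[OF \<beta> n] Gn] this, of "{1..n}"]
  show ?thesis by (simp add: H1_def obs_law_def[abs_def])
qed

section \<open>Total variation bounds\<close>

context
  fixes P Q :: "'a measure"
  assumes P: "prob_space P" and Q: "prob_space Q" and sets_eq: "sets Q = sets P"
begin

interpretation P: prob_space P by (rule P)
interpretation Q: prob_space Q by (rule Q)

lemma abs_measure_diff_le_1: "\<bar>measure P A - measure Q A\<bar> \<le> 1"
proof -
  have "measure P A \<le> 1" "measure Q A \<le> 1" "0 \<le> measure P A" "0 \<le> measure Q A" by simp_all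
  then show ?thesis by linarith
qed

lemma tv_dist_upper: "A \<in> sets P \<Longrightarrow> \<bar>measure P A - measure Q A\<bar> \<le> tv_dist P Q"
  unfolding tv_dist_def
  by (rule cSUP_upper) (auto intro!: bdd_aboveI[of _ 1] abs_measure_diff_le_1)

lemma tv_dist_least: "(\<And>A. A \<in> sets P \<Longrightarrow> \<bar>measure P A - measure Q A\<bar> \<le> c) \<Longrightarrow> tv_dist P Q \<le> c"
  unfolding tv_dist_def by (rule cSUP_least) auto

lemma tv_dist_le_1: "tv_dist P Q \<le> 1"
  by (intro tv_dist_least abs_measure_diff_le_1)

lemma tv_dist_nonneg: "0 \<le> tv_dist P Q"
  using tv_dist_upper[of "{}"] by simp

text \<open>The complement of A supplies the reverse inequality. Hence a function that merely
  minorises the density of Q, such as a truncated likelihood ratio, is enough for an upper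
  bound.\<close>

lemma tv_dist_le_one_sided:
  assumes "\<And>A. A \<in> sets P \<Longrightarrow> measure P A - c \<le> measure Q A"
  shows "tv_dist P Q \<le> c"
proof (rule tv_dist_least)
  fix A assume A: "A \<in> sets P"
  have "space Q = space P" by (rule sets_eq_imp_space_eq[OF sets_eq])
  then have "measure P (space P - A) = 1 - measure P A" "measure Q (space P - A) = 1 - measure Q A"
    using A P.prob_compl[of A] Q.prob_compl[of A] by (simp_all add: sets_eq)
  with assms[OF A] assms[of "space P - A"] A show "\<bar>measure P A - measure Q A\<bar> \<le> c"
    by auto
qed

end

text \<open>Non-negativity of the variance of |h| is the Cauchy-Schwarz inequality against the
  constant one.\<close>

lemma (in prob_space) integral_abs_le_sqrt:
  fixes h :: "'a \<Rightarrow> real"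
  assumes h: "integrable M h" and h2: "integrable M (\<lambda>x. (h x)\<^sup>2)"
  shows "(\<integral>x. \<bar>h x\<bar> \<partial>M) \<le> sqrt (\<integral>x. (h x)\<^sup>2 \<partial>M)"
proof (rule real_le_rsqrt)
  have "variance (\<lambda>x. \<bar>h x\<bar>) = expectation (\<lambda>x. (h x)\<^sup>2) - (expectation (\<lambda>x. \<bar>h x\<bar>))\<^sup>2"
    using variance_eq[of "\<lambda>x. \<bar>h x\<bar>"] h h2 by simp
  then show "(\<integral>x. \<bar>h x\<bar> \<partial>M)\<^sup>2 \<le> (\<integral>x. (h x)\<^sup>2 \<partial>M)"
    using variance_positive[of "\<lambda>x. \<bar>h x\<bar>"] by linarith
qed

text \<open>
  A second moment bound in which only the part \<open>h\<close> of the likelihood ratio \<open>f\<close> has to be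
  square integrable.
\<close>
lemma tv_dist_PiM_density_le:
  fixes f :: "'a \<Rightarrow> ennreal" and h :: "'a \<Rightarrow> real"
  assumes I: "finite I" and P: "prob_space P" and f[measurable]: "f \<in> borel_measurable P"
    and Q: "prob_space (density P f)"
    and h[measurable]: "h \<in> borel_measurable P" and h_nonneg: "\<And>x. 0 \<le> h x"
    and h_le: "\<And>x. ennreal (h x) \<le> f x"
    and b: "1 - b \<le> (\<integral>x. h x \<partial>P)"
    and V: "(\<integral>\<^sup>+x. ennreal ((h x)\<^sup>2) \<partial>P) \<le> ennreal (1 + V)" "0 \<le> V"
  shows "tv_dist (\<Pi>\<^sub>M i\<in>I. P) (\<Pi>\<^sub>M i\<in>I. density P f)
    \<le> sqrt (exp (real (card I) * V) - 1 + 2 * real (card I) * b)"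
proof -
  interpret P: prob_space P by (rule P)
  interpret PP: product_prob_space "\<lambda>_. P" I by (intro product_prob_spaceI P)
  define n where "n = card I"
  define H where "H x = (\<Prod>i\<in>I. h (x i))" for x
  let ?M = "\<Pi>\<^sub>M i\<in>I. P" and ?Q = "\<Pi>\<^sub>M i\<in>I. density P f"
  have ih2: "integrable P (\<lambda>x. (h x)\<^sup>2)"
    by (rule integrableI_nonneg) (use V(1) in \<open>auto intro: le_less_trans\<close>)
  have ih: "integrable P h"
  proof (rule P.square_integrable_imp_integrable)
  qed (use ih2 in auto)
  have ih2_le: "(\<integral>x. (h x)\<^sup>2 \<partial>P) \<le> 1 + V"
    using V by (subst integral_eq_nn_integral) (auto intro: enn2real_leI)
  have "ennreal (\<integral>x. h x \<partial>P) = (\<integral>\<^sup>+x. ennreal (h x) \<partial>P)"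
    using ih h_nonneg by (simp add: nn_integral_eq_integral)
  also have "\<dots> \<le> (\<integral>\<^sup>+x. f x \<partial>P)" by (intro nn_integral_mono h_le)
  also have "\<dots> = 1" using prob_space.emeasure_space_1[OF Q] by (simp add: emeasure_density cong: nn_integral_cong)
  finally have ih_le: "(\<integral>x. h x \<partial>P) \<le> 1" by simp
  have ih_ge: "0 \<le> (\<integral>x. h x \<partial>P)" by (simp add: h_nonneg)
  have iH: "integrable ?M H" "integrable ?M (\<lambda>x. (H x)\<^sup>2)"
    unfolding H_def prod_power_distrib
    by (intro PP.product_integrable_prod I ih ih2)+
  have IH: "(\<integral>x. H x \<partial>?M) = (\<integral>x. h x \<partial>P) ^ n" "(\<integral>x. (H x)\<^sup>2 \<partial>?M) = (\<integral>x. (h x)\<^sup>2 \<partial>P) ^ n"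
    unfolding H_def prod_power_distrib
    using PP.product_integral_prod[OF I, of "\<lambda>_. h"] PP.product_integral_prod[OF I, of "\<lambda>_ y. (h y)\<^sup>2"]
    by (simp_all add: ih ih2 n_def)
  have "1 - real n * b \<le> 1 + real n * ((\<integral>x. h x \<partial>P) - 1)"
    using b mult_left_mono[of "1 - b" "\<integral>x. h x \<partial>P" "real n"] by (simp add: algebra_simps)
  \<comment> \<open>Bernoulli's inequality, with an increment of at least -1: n factors of mean at
    least 1 - b lose at most n * b in total.\<close>
  also have "\<dots> \<le> (1 + ((\<integral>x. h x \<partial>P) - 1)) ^ n"
    using ih_ge by (intro Bernoulli_inequality) simp
  finally have H1: "1 - real n * b \<le> (\<integral>x. H x \<partial>?M)" by (simp add: IH)
  have "(\<integral>x. (H x)\<^sup>2 \<partial>?M) \<le> (1 + V) ^ n"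
    unfolding IH by (intro power_mono ih2_le) simp
  also have "\<dots> \<le> exp V ^ n" using V(2) by (intro power_mono) auto
  finally have H2: "(\<integral>x. (H x)\<^sup>2 \<partial>?M) \<le> exp (real n * V)" by (simp add: exp_of_nat_mult)
  have "(\<integral>x. \<bar>H x - 1\<bar> \<partial>?M) \<le> sqrt (\<integral>x. (H x - 1)\<^sup>2 \<partial>?M)"
    using iH by (intro PP.P.integral_abs_le_sqrt) (auto simp: power2_diff)
  also have "(\<integral>x. (H x - 1)\<^sup>2 \<partial>?M) = (\<integral>x. (H x)\<^sup>2 \<partial>?M) - 2 * (\<integral>x. H x \<partial>?M) + 1"
    using iH by (simp add: power2_diff PP.P.prob_space)
  also have "sqrt \<dots> \<le> sqrt (exp (real n * V) - 1 + 2 * real n * b)"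
    using H1 H2 by simp
  finally have abs_le: "(\<integral>x. \<bar>H x - 1\<bar> \<partial>?M) \<le> sqrt (exp (real n * V) - 1 + 2 * real n * b)" .
  have Q': "prob_space ?Q" by (intro prob_space_PiM Q)
  \<comment> \<open>Since h <= f, the product H minorises the density of \<open>?Q\<close>, so the
    one-sided criterion applies although H may integrate to less than one.\<close>
  have "tv_dist ?M ?Q \<le> (\<integral>x. \<bar>H x - 1\<bar> \<partial>?M)"
  proof (rule tv_dist_le_one_sided[OF PP.P.prob_space_axioms Q'])
    show "sets ?Q = sets ?M" by (intro sets_PiM_cong) auto
    fix A assume A[measurable]: "A \<in> sets ?M"
    have iA: "integrable ?M (\<lambda>x. H x * indicator A x)"
      using iH(1) by (intro integrable_real_mult_indicator) auto
    have ii: "integrable ?M (indicator A :: _ \<Rightarrow> real)"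
      by (intro integrable_real_indicator) (auto simp: less_top[symmetric])
    have "measure ?M A - (\<integral>x. \<bar>H x - 1\<bar> \<partial>?M) = (\<integral>x. indicator A x - \<bar>H x - 1\<bar> \<partial>?M)"
      using iH ii by (subst Bochner_Integration.integral_diff) simp_all
    also have "\<dots> \<le> (\<integral>x. H x * indicator A x \<partial>?M)"
    proof (rule integral_mono[OF _ iA])
      show "integrable ?M (\<lambda>x. indicator A x - \<bar>H x - 1\<bar>)" using iH ii by simp
      \<comment> \<open>On A this reads 1 - |H - 1| <= H, and off A it reads - |H - 1| <= 0.\<close>
      show "indicator A x - \<bar>H x - 1\<bar> \<le> H x * indicator A x" for x
        by (cases "x \<in> A") auto
    qed
    finally have 1: "measure ?M A - (\<integral>x. \<bar>H x - 1\<bar> \<partial>?M) \<le> (\<integral>x. H x * indicator A x \<partial>?M)" .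
    have "ennreal (\<integral>x. H x * indicator A x \<partial>?M) = (\<integral>\<^sup>+x. ennreal (H x * indicator A x) \<partial>?M)"
      using iA by (subst nn_integral_eq_integral) (auto simp: H_def intro!: AE_I2 mult_nonneg_nonneg prod_nonneg h_nonneg)
    also have "\<dots> \<le> (\<integral>\<^sup>+x. (\<Prod>i\<in>I. f (x i)) * indicator A x \<partial>?M)"
      unfolding H_def
      by (intro nn_integral_mono)
        (auto simp: indicator_def prod_ennreal[symmetric] h_nonneg intro!: prod_mono_ennreal h_le)
    also have "\<dots> = emeasure ?Q A"
      unfolding density_PiM[OF I P f Q, symmetric] by (subst emeasure_density) auto
    also have "\<dots> = ennreal (measure ?Q A)"
      using prob_space.finite_measure[OF Q'] by (simp add: finite_measure.emeasure_eq_measure)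
    finally have "(\<integral>x. H x * indicator A x \<partial>?M) \<le> measure ?Q A" by simp
    with 1 show "measure ?M A - (\<integral>x. \<bar>H x - 1\<bar> \<partial>?M) \<le> measure ?Q A" by simp
  qed
  with abs_le show ?thesis by (simp add: n_def)
qed

section \<open>Gaussian tilting and the likelihood ratio of one observation\<close>

text \<open>The factor exp (mu * x - mu^2 / 2) is the likelihood ratio of N(mu, 1) against N(0, 1),
  by completing the square.\<close>

lemma std_normal_tilt: "std_normal_density x * exp (\<mu> * x - \<mu>\<^sup>2 / 2) = normal_density \<mu> 1 x"
proof -
  have e: "- x\<^sup>2 / 2 + (\<mu> * x - \<mu>\<^sup>2 / 2) = - (x - \<mu>)\<^sup>2 / 2"
    by (simp add: power2_eq_square field_simps)
  have "exp (- x\<^sup>2 / 2) * exp (\<mu> * x - \<mu>\<^sup>2 / 2) = exp (- (x - \<mu>)\<^sup>2 / 2)"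
    by (simp only: exp_add[symmetric] e)
  then show ?thesis by (simp add: normal_density_def)
qed

lemma nn_integral_gauss:
  "f \<in> borel_measurable borel \<Longrightarrow>
    (\<integral>\<^sup>+x. f x \<partial>gauss \<mu>) = (\<integral>\<^sup>+x. ennreal (normal_density \<mu> 1 x) * f x \<partial>lborel)"
  by (subst nn_integral_density) auto

lemma nn_integral_exp_gauss: "(\<integral>\<^sup>+x. ennreal (exp (c * x)) \<partial>gauss 0) = ennreal (exp (c\<^sup>2 / 2))"
proof -
  have "(\<integral>\<^sup>+x. ennreal (exp (c * x)) \<partial>gauss 0)
      = (\<integral>\<^sup>+x. ennreal (exp (c\<^sup>2 / 2)) * ennreal (normal_density c 1 x) \<partial>lborel)"
    by (subst nn_integral_gauss)
      (auto simp: std_normal_tilt[of _ c, symmetric] exp_diff ennreal_mult''[symmetric] intro!: nn_integral_cong)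
  also have "\<dots> = ennreal (exp (c\<^sup>2 / 2)) * emeasure (gauss c) UNIV"
    by (subst nn_integral_cmult) (auto simp: emeasure_density)
  also have "emeasure (gauss c) UNIV = 1"
    using prob_space.emeasure_space_1[OF prob_space_gauss[of c]] by simp
  finally show ?thesis by simp
qed

text \<open>The likelihood ratio, against N(0, 1), of a normal observation whose mean is drawn from
  G. Values in \<open>ennreal\<close> allow Tonelli exchanges without integrability conditions;
  finiteness is established in \<open>tv_dist_le\<close>, where real values are required.\<close>

definition likelihood_ratio :: "real measure \<Rightarrow> real \<Rightarrow> ennreal" where
  "likelihood_ratio G x = (\<integral>\<^sup>+\<mu>. ennreal (exp (\<mu> * x - \<mu>\<^sup>2 / 2)) \<partial>G)"

lemma measurable_likelihood_ratio[measurable]: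
  assumes "real_distribution G"
  shows "likelihood_ratio G \<in> borel_measurable borel"
proof -
  interpret real_distribution G by fact
  show ?thesis unfolding likelihood_ratio_def[abs_def] by measurable
qed

context
  fixes p :: real and G :: "real measure"
  assumes p: "0 \<le> p" "p \<le> 1" and G: "real_distribution G"
begin

interpretation G: real_distribution G by (rule G)

lemma measurable_gauss_sparse_mixture:
  "gauss \<in> measurable (sparse_mixture p G) (prob_algebra borel)"
  using measurable_gauss measurable_cong_sets[OF sets_sparse_mixture[OF p G] refl] by blast

lemma emeasure_marginal:
  assumes "A \<in> sets borel"
  shows "emeasure (sparse_mixture p G \<bind> gauss) A
    = ennreal (1 - p) * emeasure (gauss 0) A + ennreal p * (\<integral>\<^sup>+\<mu>. emeasure (gauss \<mu>) A \<partial>G)"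
proof -
  have "emeasure (sparse_mixture p G \<bind> gauss) A = (\<integral>\<^sup>+\<mu>. emeasure (gauss \<mu>) A \<partial>sparse_mixture p G)"
    using assms
    by (intro emeasure_bind_prob_algebra[of _ "sparse_mixture p G" _ borel] measurable_gauss_sparse_mixture)
      (auto simp: space_prob_algebra prob_space_sparse_mixture[OF p G])
  also have "\<dots> = ennreal (1 - p) * emeasure (gauss 0) A + ennreal p * (\<integral>\<^sup>+\<mu>. emeasure (gauss \<mu>) A \<partial>G)"
    using measurable_emeasure_kernel[OF measurable_prob_algebraD[OF measurable_gauss] assms]
    by (rule nn_integral_sparse_mixture[OF p G])
  finally show ?thesis .
qed

lemma prob_space_marginal: "prob_space (sparse_mixture p G \<bind> gauss)"
  by (rule prob_space_bind'[OF _ measurable_gauss_sparse_mixture])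
    (simp add: space_prob_algebra prob_space_sparse_mixture[OF p G])

lemma sets_marginal: "sets (sparse_mixture p G \<bind> gauss) = sets borel"
  by (rule sets_bind'[OF _ measurable_gauss_sparse_mixture])
    (simp add: space_prob_algebra prob_space_sparse_mixture[OF p G])

text \<open>Every N(mu, 1) density is written as a tilt of the standard one, and Tonelli's theorem
  then exchanges the integrals over mean and observation.\<close>

lemma marginal_eq_density:
  "sparse_mixture p G \<bind> gauss
    = density (gauss 0) (\<lambda>x. ennreal (1 - p) + ennreal p * likelihood_ratio G x)"
proof (rule measure_eqI)
  fix A assume "A \<in> sets (sparse_mixture p G \<bind> gauss)"
  then have A[measurable]: "A \<in> sets borel" by (simp add: sets_marginal)
  interpret pair_sigma_finite G lborel ..
  note [measurable] = measurable_likelihood_ratio[OF G]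
  have "(\<integral>\<^sup>+\<mu>. emeasure (gauss \<mu>) A \<partial>G)
      = (\<integral>\<^sup>+\<mu>. \<integral>\<^sup>+x. ennreal (std_normal_density x * exp (\<mu> * x - \<mu>\<^sup>2 / 2)) * indicator A x \<partial>lborel \<partial>G)"
    by (simp add: emeasure_density std_normal_tilt)
  also have "\<dots> = (\<integral>\<^sup>+x. \<integral>\<^sup>+\<mu>. ennreal (std_normal_density x * exp (\<mu> * x - \<mu>\<^sup>2 / 2)) * indicator A x \<partial>G \<partial>lborel)"
    by (rule Fubini'[symmetric]) measurable
  also have "\<dots> = (\<integral>\<^sup>+x. ennreal (std_normal_density x) * (likelihood_ratio G x * indicator A x) \<partial>lborel)"
    unfolding likelihood_ratio_def
    by (intro nn_integral_cong) (simp add: ennreal_mult' nn_integral_cmult nn_integral_multc mult.assoc)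
  also have "\<dots> = (\<integral>\<^sup>+x. likelihood_ratio G x * indicator A x \<partial>gauss 0)"
    by (subst nn_integral_gauss) auto
  finally have *: "(\<integral>\<^sup>+\<mu>. emeasure (gauss \<mu>) A \<partial>G) = (\<integral>\<^sup>+x. likelihood_ratio G x * indicator A x \<partial>gauss 0)" .
  have "emeasure (density (gauss 0) (\<lambda>x. ennreal (1 - p) + ennreal p * likelihood_ratio G x)) A
      = (\<integral>\<^sup>+x. ennreal (1 - p) * indicator A x + ennreal p * (likelihood_ratio G x * indicator A x) \<partial>gauss 0)"
    by (subst emeasure_density) (auto intro!: nn_integral_cong simp: algebra_simps)
  also have "\<dots> = ennreal (1 - p) * emeasure (gauss 0) A + ennreal p * (\<integral>\<^sup>+x. likelihood_ratio G x * indicator A x \<partial>gauss 0)"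
    by (subst nn_integral_add) (auto simp: nn_integral_cmult)
  finally show "emeasure (sparse_mixture p G \<bind> gauss) A
    = emeasure (density (gauss 0) (\<lambda>x. ennreal (1 - p) + ennreal p * likelihood_ratio G x)) A"
    by (simp add: emeasure_marginal * )
qed (simp add: sets_marginal)

end

section \<open>Elementary tail estimates\<close>

lemma nn_integral_exp_tail:
  assumes "0 < k"
  shows "(\<integral>\<^sup>+x. ennreal (exp (- (k * (x - t)))) * indicator {t..} x \<partial>lborel) = ennreal (1 / k)"
proof -
  have "(\<integral>\<^sup>+x. ennreal (exp (- (k * (x - t)))) * indicator {t..} x \<partial>lborel)
      = ennreal (0 - (- exp (- (k * (t - t))) / k))"
  proof (rule nn_integral_FTC_atLeast[where F = "\<lambda>x. - exp (- (k * (x - t))) / k"])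
    show "((\<lambda>x. - exp (- (k * (x - t))) / k) \<longlongrightarrow> 0) at_top"
      using assms by real_asymp
    show "((\<lambda>x. - exp (- (k * (x - t))) / k) has_real_derivative exp (- (k * (x - t)))) (at x)" for x
      using assms by (auto intro!: derivative_eq_intros)
  qed auto
  then show ?thesis by simp
qed

lemma ennreal_sum_square_le: "(x + y)\<^sup>2 \<le> 2 * x\<^sup>2 + 2 * (y::ennreal)\<^sup>2"
proof (cases x; cases y)
  fix r s assume "x = ennreal r" "0 \<le> r" "y = ennreal s" "0 \<le> s"
  moreover have "(r + s)\<^sup>2 \<le> 2 * r\<^sup>2 + 2 * s\<^sup>2"
    using zero_le_power2[of "r - s"] by (simp add: power2_eq_square algebra_simps)
  ultimately show ?thesis
    by (simp add: ennreal_power ennreal_mult'[symmetric] flip: ennreal_plus ennreal_numeral)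
qed (auto simp: ennreal_mult_top power2_eq_square)

lemma std_normal_density_le: "std_normal_density x \<le> exp (- (x\<^sup>2 / 2))"
proof -
  have "sqrt 1 \<le> sqrt (2 * pi)" using pi_gt3 by (intro real_sqrt_le_mono) simp
  then show ?thesis by (simp add: std_normal_density_def divide_le_eq)
qed

text \<open>The parabola x^2 / 2 lies above its tangent at t, which leaves an exponential tail of
  rate t. The factor 1 / t matters: at t = sqrt (2 ln n) the exponential alone gives 1 / n, and n
  such terms must still sum to something vanishing.\<close>

lemma gauss_tail_le:
  assumes "0 < t"
  shows "measure (gauss 0) {t<..} \<le> exp (- (t\<^sup>2 / 2)) / t"
proof -
  have "emeasure (gauss 0) {t<..} = (\<integral>\<^sup>+x. ennreal (std_normal_density x) * indicator {t<..} x \<partial>lborel)"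
    by (simp add: emeasure_density)
  also have "\<dots> \<le> (\<integral>\<^sup>+x. ennreal (exp (- (t\<^sup>2 / 2))) * (ennreal (exp (- (t * (x - t)))) * indicator {t..} x) \<partial>lborel)"
  proof (rule nn_integral_mono)
    fix x :: real
    have "0 \<le> (x - t)\<^sup>2" by simp
    then have e: "- x\<^sup>2 / 2 \<le> - (t\<^sup>2 / 2) + - (t * (x - t))"
      by (simp add: power2_eq_square algebra_simps)
    have "std_normal_density x \<le> exp (- x\<^sup>2 / 2)"
      using std_normal_density_le[of x] by simp
    also have "\<dots> \<le> exp (- (t\<^sup>2 / 2)) * exp (- (t * (x - t)))"
      using e by (simp only: exp_add[symmetric] exp_le_cancel_iff)
    finally show "ennreal (std_normal_density x) * indicator {t<..} x
        \<le> ennreal (exp (- (t\<^sup>2 / 2))) * (ennreal (exp (- (t * (x - t)))) * indicator {t..} x)"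
      by (auto simp: indicator_def ennreal_mult'[symmetric])
  qed
  also have "\<dots> = ennreal (exp (- (t\<^sup>2 / 2)) / t)"
    using assms by (subst nn_integral_cmult) (auto simp: nn_integral_exp_tail ennreal_mult'[symmetric])
  finally show ?thesis
    using assms prob_space.finite_measure[OF prob_space_gauss[of 0]]
    by (simp add: finite_measure.emeasure_eq_measure)
qed

text \<open>Only a window of unit length is kept, at distance t - m to t - m + 1 above the mean. It
  lies to the right of t because the mean is at least m, and the density is smallest at its far
  end.\<close>

lemma gauss_tail_ge:
  assumes "m \<le> t" "m \<le> \<mu>"
  shows "std_normal_density (t - m + 1) \<le> measure (gauss \<mu>) {t<..}"
proof -
  have "ennreal (std_normal_density (t - m + 1))
      = (\<integral>\<^sup>+x. ennreal (std_normal_density (t - m + 1)) * indicator {t - m + \<mu><..<t - m + \<mu> + 1} x \<partial>lborel)"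
    by (simp add: nn_integral_cmult)
  also have "\<dots> \<le> (\<integral>\<^sup>+x. ennreal (normal_density \<mu> 1 x) * indicator {t<..} x \<partial>lborel)"
  proof (rule nn_integral_mono)
    fix x :: real
    have "std_normal_density (t - m + 1) \<le> normal_density \<mu> 1 x" if "t - m + \<mu> < x" "x < t - m + \<mu> + 1"
    proof -
      have "(x - \<mu>)\<^sup>2 \<le> (t - m + 1)\<^sup>2" using that assms by (intro power_mono) auto
      then show ?thesis by (simp add: normal_density_def divide_right_mono)
    qed
    then show "ennreal (std_normal_density (t - m + 1)) * indicator {t - m + \<mu><..<t - m + \<mu> + 1} x
      \<le> ennreal (normal_density \<mu> 1 x) * indicator {t<..} x"
      using assms by (auto simp: indicator_def)
  qed
  also have "\<dots> = emeasure (gauss \<mu>) {t<..}" by (simp add: emeasure_density)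
  finally show ?thesis
    using prob_space.finite_measure[OF prob_space_gauss[of \<mu>]]
    by (simp add: finite_measure.emeasure_eq_measure)
qed

lemma measure_PiM_box:
  assumes I: "finite I" and P: "prob_space P" and A: "A \<in> sets P"
  shows "measure (\<Pi>\<^sub>M i\<in>I. P) (\<Pi>\<^sub>E i\<in>I. A) = measure P A ^ card I"
proof -
  interpret prob_space P by (rule P)
  interpret finite_product_prob_space "\<lambda>_. P" I by standard (rule I)
  show ?thesis using prob_times[of "\<lambda>_. A"] A by simp
qed

section \<open>Bounds on the total variation distance at a fixed sample size\<close>

text \<open>The part of the likelihood ratio due to means of modulus above \<open>a\<close>. The
  cut-off stays fixed as n grows, so the remaining means have a bounded second moment and the tail
  of g matters only here.\<close>

definition tail_ratio :: "real measure \<Rightarrow> real \<Rightarrow> real \<Rightarrow> ennreal" where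
  "tail_ratio G a x = (\<integral>\<^sup>+\<mu>. ennreal (exp (\<mu> * x - \<mu>\<^sup>2 / 2)) * indicator {\<mu>. a < \<bar>\<mu>\<bar>} \<mu> \<partial>G)"

lemma measurable_tail_ratio[measurable]:
  assumes "real_distribution G"
  shows "tail_ratio G a \<in> borel_measurable borel"
proof -
  interpret real_distribution G by fact
  show ?thesis unfolding tail_ratio_def[abs_def] by measurable
qed

context
  fixes \<beta> :: real and n :: nat and Gn :: "nat \<Rightarrow> real measure" and \<epsilon> :: real
  assumes \<beta>: "0 \<le> \<beta>" and n: "1 \<le> n" and Gn: "real_distribution (Gn n)"
  defines "\<epsilon> \<equiv> real n powr - \<beta>"
begin

interpretation G: real_distribution "Gn n" by (rule Gn)

lemma emeasure_Gn_UNIV: "emeasure (Gn n) UNIV = 1"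
  using G.emeasure_space_1 by simp

lemma weight: "0 \<le> \<epsilon>" "\<epsilon> \<le> 1"
  using weight_bounds[OF \<beta> n] by (simp_all add: \<epsilon>_def)

lemma prob_space_H0: "prob_space (H0 n)"
  unfolding H0_eq by (intro prob_space_PiM prob_space_gauss)

lemma H1_eq_PiM: "H1 Gn \<beta> n = (\<Pi>\<^sub>M i\<in>{1..n}. sparse_mixture \<epsilon> (Gn n) \<bind> gauss)"
  using H1_eq[of \<beta> n Gn, OF \<beta> n Gn] by (simp add: \<epsilon>_def)

lemma prob_space_H1: "prob_space (H1 Gn \<beta> n)"
  unfolding H1_eq_PiM by (intro prob_space_PiM prob_space_marginal weight Gn)

lemma sets_H1: "sets (H1 Gn \<beta> n) = sets (H0 n)"
  unfolding H1_eq_PiM H0_eq by (intro sets_PiM_cong refl) (simp add: sets_marginal[OF weight Gn])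

text \<open>Exceedances of t that stem from the null component or from means at most m are simply
  dropped.\<close>

lemma marginal_tail_ge:
  assumes "m \<le> t"
  shows "\<epsilon> * (measure (Gn n) {m<..} * std_normal_density (t - m + 1))
    \<le> measure (sparse_mixture \<epsilon> (Gn n) \<bind> gauss) {t<..}"
proof -
  have "ennreal (measure (Gn n) {m<..} * std_normal_density (t - m + 1))
      = (\<integral>\<^sup>+\<mu>. ennreal (std_normal_density (t - m + 1)) * indicator {m<..} \<mu> \<partial>Gn n)"
    by (subst nn_integral_cmult_indicator)
      (auto simp: G.emeasure_eq_measure ennreal_mult'[symmetric] mult.commute)
  also have "\<dots> \<le> (\<integral>\<^sup>+\<mu>. emeasure (gauss \<mu>) {t<..} \<partial>Gn n)"
    using gauss_tail_ge[OF assms] prob_space.finite_measure[OF prob_space_gauss]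
    by (intro nn_integral_mono) (auto simp: indicator_def finite_measure.emeasure_eq_measure)
  finally have "ennreal \<epsilon> * ennreal (measure (Gn n) {m<..} * std_normal_density (t - m + 1))
      \<le> ennreal \<epsilon> * (\<integral>\<^sup>+\<mu>. emeasure (gauss \<mu>) {t<..} \<partial>Gn n)"
    by (intro mult_left_mono) auto
  then have "ennreal \<epsilon> * ennreal (measure (Gn n) {m<..} * std_normal_density (t - m + 1))
      \<le> ennreal (1 - \<epsilon>) * emeasure (gauss 0) {t<..} + ennreal \<epsilon> * (\<integral>\<^sup>+\<mu>. emeasure (gauss \<mu>) {t<..} \<partial>Gn n)"
    by (rule order_trans) simp
  also have "\<dots> = emeasure (sparse_mixture \<epsilon> (Gn n) \<bind> gauss) {t<..}"
    by (subst emeasure_marginal[OF weight Gn]) auto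
  finally show ?thesis
    using weight prob_space.finite_measure[OF prob_space_marginal[OF weight Gn]]
    by (simp add: finite_measure.emeasure_eq_measure ennreal_mult'[symmetric])
qed

text \<open>The test rejects when the largest observation exceeds \<open>t\<close>.\<close>
lemma tv_dist_ge:
  assumes t: "0 < t" and m: "m \<le> t"
  shows "1 - real n * (exp (- (t\<^sup>2 / 2)) / t)
      - exp (- (real n * (\<epsilon> * (measure (Gn n) {m<..} * std_normal_density (t - m + 1)))))
    \<le> tv_dist (H0 n) (H1 Gn \<beta> n)"
proof -
  let ?Q = "sparse_mixture \<epsilon> (Gn n) \<bind> gauss"
  \<comment> \<open>The acceptance region, in which no observation exceeds t. Bernoulli's inequality
    bounds its probability from below under H0, and 1 - q <= exp (- q) bounds it from above under
    H1.\<close>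
  let ?B = "\<Pi>\<^sub>E i\<in>{1..n}. {..t}"
  interpret P: prob_space "gauss 0" by (rule prob_space_gauss)
  interpret Q: prob_space ?Q by (rule prob_space_marginal[OF weight Gn])
  have sQ: "sets ?Q = sets borel" by (rule sets_marginal[OF weight Gn])
  have spQ: "space ?Q = UNIV" using sets_eq_imp_space_eq[OF sQ] by simp
  have c: "UNIV - {..t} = {t<..}" by auto
  have P1: "P.prob {..t} = 1 - P.prob {t<..}"
    using P.prob_compl[of "{..t}"] by (simp add: c)
  have Q1: "Q.prob {..t} = 1 - Q.prob {t<..}"
    using Q.prob_compl[of "{..t}"] by (simp add: c sQ spQ)
  have "1 - real n * (exp (- (t\<^sup>2 / 2)) / t) \<le> 1 - real n * P.prob {t<..}"
    by (intro diff_left_mono mult_left_mono gauss_tail_le[OF t]) simp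
  also have "\<dots> \<le> P.prob {..t} ^ n"
    using Bernoulli_inequality[of "- P.prob {t<..}" n] by (simp add: P1)
  also have "\<dots> = measure (H0 n) ?B"
    unfolding H0_eq by (subst measure_PiM_box) (auto intro: prob_space_gauss)
  finally have P2: "1 - real n * (exp (- (t\<^sup>2 / 2)) / t) \<le> measure (H0 n) ?B" .
  have "measure (H1 Gn \<beta> n) ?B = Q.prob {..t} ^ n"
    unfolding H1_eq_PiM by (subst measure_PiM_box) (auto simp: sQ intro: Q.prob_space_axioms)
  also have "\<dots> \<le> exp (- Q.prob {t<..}) ^ n"
    unfolding Q1 using exp_ge_add_one_self[of "- Q.prob {t<..}"] by (intro power_mono) auto
  also have "\<dots> = exp (- (real n * Q.prob {t<..}))" by (simp add: exp_of_nat_mult[symmetric])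
  also have "\<dots> \<le> exp (- (real n * (\<epsilon> * (measure (Gn n) {m<..} * std_normal_density (t - m + 1)))))"
    using marginal_tail_ge[OF m] by (simp add: mult_left_mono)
  finally have Q2: "measure (H1 Gn \<beta> n) ?B
    \<le> exp (- (real n * (\<epsilon> * (measure (Gn n) {m<..} * std_normal_density (t - m + 1)))))" .
  have B: "?B \<in> sets (H0 n)" unfolding H0_eq by (intro sets_PiM_I_finite) auto
  show ?thesis
    using tv_dist_upper[OF prob_space_H0 prob_space_H1 sets_H1 B] P2 Q2 by linarith
qed

text \<open>The likelihood ratio splits into means of modulus at most \<open>a\<close>
  (\<open>l1\<close>), larger means at |x| <= t (\<open>l2\<close>) and larger means at |x| > t
  (\<open>l3\<close>). Only \<open>l3\<close> is dropped, at the cost of \<epsilon> * b in the mean.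
  Bounding exp (2 a |x|) by the sum over both signs gives 2 exp (2 a^2) for the square of
  \<open>l1\<close>, and the square of a sum contributes another factor 2.\<close>

lemma tv_dist_le:
  assumes b: "(\<integral>\<^sup>+x. tail_ratio (Gn n) a x * indicator {x. t < \<bar>x\<bar>} x \<partial>gauss 0) \<le> ennreal b" "0 \<le> b"
    and V: "(\<integral>\<^sup>+x. (tail_ratio (Gn n) a x)\<^sup>2 * indicator {x. \<bar>x\<bar> \<le> t} x \<partial>gauss 0) \<le> ennreal V" "0 \<le> V"
    and a: "0 \<le> a"
  shows "tv_dist (H0 n) (H1 Gn \<beta> n)
    \<le> sqrt (exp (real n * (\<epsilon>\<^sup>2 * (4 * exp (2 * a\<^sup>2) + 2 * V))) - 1 + 2 * real n * (\<epsilon> * b))"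
proof -
  let ?Q = "sparse_mixture \<epsilon> (Gn n) \<bind> gauss"
  note [measurable] = measurable_tail_ratio[OF Gn, of a] measurable_likelihood_ratio[OF Gn]
  interpret P: prob_space "gauss 0" by (rule prob_space_gauss)
  define f where "f x = ennreal (1 - \<epsilon>) + ennreal \<epsilon> * likelihood_ratio (Gn n) x" for x
  define l1 where "l1 x = (\<integral>\<^sup>+\<mu>. ennreal (exp (\<mu> * x - \<mu>\<^sup>2 / 2)) * indicator {\<mu>. \<bar>\<mu>\<bar> \<le> a} \<mu> \<partial>Gn n)" for x
  define l2 where "l2 x = tail_ratio (Gn n) a x * indicator {x. \<bar>x\<bar> \<le> t} x" for x
  define l3 where "l3 x = tail_ratio (Gn n) a x * indicator {x. t < \<bar>x\<bar>} x" for x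
  define h where "h x = (1 - \<epsilon>) + \<epsilon> * enn2real (l1 x + l2 x)" for x
  have [measurable]: "f \<in> borel_measurable borel" "l1 \<in> borel_measurable borel"
    "l2 \<in> borel_measurable borel" "l3 \<in> borel_measurable borel"
    unfolding f_def[abs_def] l1_def[abs_def] l2_def[abs_def] l3_def[abs_def] by measurable
  then have [measurable]: "h \<in> borel_measurable borel" unfolding h_def[abs_def] by measurable
  have "likelihood_ratio (Gn n) x = l1 x + tail_ratio (Gn n) a x" for x
    unfolding l1_def tail_ratio_def likelihood_ratio_def
    by (subst nn_integral_add[symmetric]) (auto intro!: nn_integral_cong simp: indicator_def)
  moreover have "tail_ratio (Gn n) a x = l2 x + l3 x" for x
    by (simp add: l2_def l3_def indicator_def)
  ultimately have lr: "likelihood_ratio (Gn n) x = l1 x + l2 x + l3 x" for x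
    by (simp add: add.assoc)
  \<comment> \<open>The exponent mu * x - mu^2 / 2 never exceeds x^2 / 2, so the ratio is finite at
    every point and \<open>enn2real\<close> in \<open>h\<close> loses nothing.\<close>
  have "likelihood_ratio (Gn n) x \<le> (\<integral>\<^sup>+\<mu>. ennreal (exp (x\<^sup>2 / 2)) \<partial>Gn n)" for x
    unfolding likelihood_ratio_def
  proof (intro nn_integral_mono ennreal_leI)
    fix \<mu> :: real
    have "0 \<le> (x - \<mu>)\<^sup>2" by simp
    then show "exp (\<mu> * x - \<mu>\<^sup>2 / 2) \<le> exp (x\<^sup>2 / 2)"
      by (simp add: power2_eq_square algebra_simps)
  qed
  then have "likelihood_ratio (Gn n) x < \<infinity>" for x
    by (rule le_less_trans) (simp add: emeasure_Gn_UNIV)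
  then have fin: "l1 x + l2 x < \<infinity>" for x
    using le_less_trans[of "l1 x + l2 x" "likelihood_ratio (Gn n) x" \<infinity>] by (simp add: lr)
  have h: "ennreal (h x) = ennreal (1 - \<epsilon>) + ennreal \<epsilon> * (l1 x + l2 x)" for x
    using fin weight by (simp add: h_def ennreal_mult')
  have Q: "density (gauss 0) f = ?Q"
    unfolding f_def[abs_def] by (rule marginal_eq_density[OF weight Gn, symmetric])
  have Qp: "prob_space (density (gauss 0) f)"
    unfolding Q by (rule prob_space_marginal[OF weight Gn])
  have f_eq: "f x = ennreal (h x) + ennreal \<epsilon> * l3 x" for x
    by (simp add: f_def h lr distrib_left add.assoc)
  have f1: "(\<integral>\<^sup>+x. f x \<partial>gauss 0) = 1"
    using prob_space.emeasure_space_1[OF Qp] by (simp add: emeasure_density cong: nn_integral_cong)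
  have split: "1 = (\<integral>\<^sup>+x. ennreal (h x) \<partial>gauss 0) + ennreal \<epsilon> * (\<integral>\<^sup>+x. l3 x \<partial>gauss 0)"
    unfolding f1[symmetric] f_eq by (subst nn_integral_add) (auto simp: nn_integral_cmult)
  also have "\<dots> \<le> (\<integral>\<^sup>+x. ennreal (h x) \<partial>gauss 0) + ennreal \<epsilon> * ennreal b"
    using b(1) unfolding l3_def by (intro add_left_mono mult_left_mono) auto
  finally have "1 \<le> (\<integral>\<^sup>+x. ennreal (h x) \<partial>gauss 0) + ennreal (\<epsilon> * b)"
    using weight by (simp add: ennreal_mult')
  moreover have hn: "0 \<le> h x" for x using weight by (simp add: h_def)
  moreover have hl1: "(\<integral>\<^sup>+x. ennreal (h x) \<partial>gauss 0) \<le> 1" unfolding split by simp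
  moreover have ih: "integrable (gauss 0) h"
    using hl1 hn by (intro integrableI_nonneg) (auto intro: le_less_trans)
  ultimately have h_ge: "1 - \<epsilon> * b \<le> (\<integral>x. h x \<partial>gauss 0)"
    using weight b(2) by (simp add: nn_integral_eq_integral flip: ennreal_plus ennreal_1)
  have l1_le: "l1 x \<le> ennreal (exp (a * \<bar>x\<bar>))" for x
  proof -
    have "l1 x \<le> (\<integral>\<^sup>+\<mu>. ennreal (exp (a * \<bar>x\<bar>)) \<partial>Gn n)"
      unfolding l1_def
    proof (intro nn_integral_mono)
      fix \<mu> :: real
      have "\<mu> * x - \<mu>\<^sup>2 / 2 \<le> a * \<bar>x\<bar>" if "\<bar>\<mu>\<bar> \<le> a"
      proof -
        have "\<mu> * x \<le> \<bar>\<mu>\<bar> * \<bar>x\<bar>" unfolding abs_mult[symmetric] by simp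
        also have "\<dots> \<le> a * \<bar>x\<bar>" using that by (intro mult_right_mono) auto
        finally show ?thesis using zero_le_power2[of \<mu>] by linarith
      qed
      then show "ennreal (exp (\<mu> * x - \<mu>\<^sup>2 / 2)) * indicator {\<mu>. \<bar>\<mu>\<bar> \<le> a} \<mu> \<le> ennreal (exp (a * \<bar>x\<bar>))"
        by (auto simp: indicator_def)
    qed
    then show ?thesis by (simp add: emeasure_Gn_UNIV)
  qed
  have "(\<integral>\<^sup>+x. (l1 x)\<^sup>2 \<partial>gauss 0) \<le> (\<integral>\<^sup>+x. ennreal (exp ((2 * a) * x)) + ennreal (exp ((- 2 * a) * x)) \<partial>gauss 0)"
  proof (rule nn_integral_mono)
    fix x :: real
    have "(l1 x)\<^sup>2 \<le> (ennreal (exp (a * \<bar>x\<bar>)))\<^sup>2" by (intro power_mono l1_le) auto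
    also have "\<dots> = ennreal (exp (2 * (a * \<bar>x\<bar>)))"
      by (simp add: ennreal_power exp_double)
    also have "\<dots> \<le> ennreal (exp ((2 * a) * x) + exp ((- 2 * a) * x))"
      by (intro ennreal_leI) (auto simp: abs_if mult.assoc intro: add_increasing add_increasing2)
    finally show "(l1 x)\<^sup>2 \<le> ennreal (exp ((2 * a) * x)) + ennreal (exp ((- 2 * a) * x))" by simp
  qed
  also have "\<dots> = ennreal (2 * exp (2 * a\<^sup>2))"
    by (subst nn_integral_add) (auto simp only: nn_integral_exp_gauss, auto simp: power_mult_distrib simp flip: ennreal_plus)
  finally have l1_sq: "(\<integral>\<^sup>+x. (l1 x)\<^sup>2 \<partial>gauss 0) \<le> ennreal (2 * exp (2 * a\<^sup>2))" .
  have l2_sq: "(\<integral>\<^sup>+x. (l2 x)\<^sup>2 \<partial>gauss 0) \<le> ennreal V"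
    using V(1) by (rule order_trans[rotated]) (auto intro!: nn_integral_mono simp: l2_def indicator_def)
  have "(\<integral>\<^sup>+x. (l1 x + l2 x)\<^sup>2 \<partial>gauss 0) \<le> (\<integral>\<^sup>+x. 2 * (l1 x)\<^sup>2 + 2 * (l2 x)\<^sup>2 \<partial>gauss 0)"
    by (intro nn_integral_mono ennreal_sum_square_le)
  also have "\<dots> = 2 * (\<integral>\<^sup>+x. (l1 x)\<^sup>2 \<partial>gauss 0) + 2 * (\<integral>\<^sup>+x. (l2 x)\<^sup>2 \<partial>gauss 0)"
    by (subst nn_integral_add) (auto simp: nn_integral_cmult)
  also have "\<dots> \<le> 2 * ennreal (2 * exp (2 * a\<^sup>2)) + 2 * ennreal V"
    using l1_sq l2_sq by (intro add_mono mult_left_mono) auto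
  also have "\<dots> = ennreal (4 * exp (2 * a\<^sup>2) + 2 * V)"
  proof -
    have "2 * ennreal y = ennreal (2 * y)" if "0 \<le> y" for y
      using that by (simp add: ennreal_mult')
    then show ?thesis using V(2) by (simp flip: ennreal_plus)
  qed
  finally have l_sq: "(\<integral>\<^sup>+x. (l1 x + l2 x)\<^sup>2 \<partial>gauss 0) \<le> ennreal (4 * exp (2 * a\<^sup>2) + 2 * V)" .
  let ?I = "\<integral>\<^sup>+x. ennreal ((h x)\<^sup>2) \<partial>gauss 0"
  \<comment> \<open>This is the expansion of the square of (1 - \<epsilon>) + \<epsilon> * (l1 +
    l2), arranged without subtraction as \<open>ennreal\<close> requires. Since h has mean at most
    one, it gives E h^2 <= 1 - \<epsilon>^2 + \<epsilon>^2 * E (l1 + l2)^2.\<close>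
  have sq: "ennreal ((h x)\<^sup>2) + ennreal ((1 - \<epsilon>)\<^sup>2)
      = ennreal (\<epsilon>\<^sup>2) * (l1 x + l2 x)\<^sup>2 + ennreal (2 * (1 - \<epsilon>)) * ennreal (h x)" for x
  proof -
    obtain r where r: "l1 x + l2 x = ennreal r" "0 \<le> r" using fin[of x] by (cases "l1 x + l2 x") auto
    have hr: "h x = 1 - \<epsilon> + \<epsilon> * r" using r by (simp add: h_def)
    have "(h x)\<^sup>2 + (1 - \<epsilon>)\<^sup>2 = \<epsilon>\<^sup>2 * r\<^sup>2 + 2 * (1 - \<epsilon>) * h x"
      unfolding hr by (simp add: power2_eq_square algebra_simps)
    then show ?thesis
      using weight r hn[of x] by (simp add: ennreal_power ennreal_mult'[symmetric] flip: ennreal_plus)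
  qed
  have "?I + ennreal ((1 - \<epsilon>)\<^sup>2) = (\<integral>\<^sup>+x. ennreal ((h x)\<^sup>2) + ennreal ((1 - \<epsilon>)\<^sup>2) \<partial>gauss 0)"
    using P.emeasure_space_1 by (subst nn_integral_add) auto
  also have "\<dots> = ennreal (\<epsilon>\<^sup>2) * (\<integral>\<^sup>+x. (l1 x + l2 x)\<^sup>2 \<partial>gauss 0)
      + ennreal (2 * (1 - \<epsilon>)) * (\<integral>\<^sup>+x. ennreal (h x) \<partial>gauss 0)"
    unfolding sq by (subst nn_integral_add) (auto simp: nn_integral_cmult)
  also have "\<dots> \<le> ennreal (\<epsilon>\<^sup>2) * ennreal (4 * exp (2 * a\<^sup>2) + 2 * V) + ennreal (2 * (1 - \<epsilon>)) * 1"
    using l_sq hl1 by (intro add_mono mult_left_mono) auto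
  also have "\<dots> = ennreal (\<epsilon>\<^sup>2 * (4 * exp (2 * a\<^sup>2) + 2 * V) + 2 * (1 - \<epsilon>))"
    using weight V(2) by (simp add: ennreal_mult'[symmetric] flip: ennreal_plus)
  finally have I: "?I + ennreal ((1 - \<epsilon>)\<^sup>2) \<le> \<dots>" .
  have "?I \<le> ennreal (1 + \<epsilon>\<^sup>2 * (4 * exp (2 * a\<^sup>2) + 2 * V))"
  proof (cases ?I)
    case (real r)
    with I have "r + (1 - \<epsilon>)\<^sup>2 \<le> \<epsilon>\<^sup>2 * (4 * exp (2 * a\<^sup>2) + 2 * V) + 2 * (1 - \<epsilon>)"
      using weight V(2) by (simp flip: ennreal_plus)
    then have "r + \<epsilon>\<^sup>2 \<le> 1 + \<epsilon>\<^sup>2 * (4 * exp (2 * a\<^sup>2) + 2 * V)"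
      by (simp add: power2_diff)
    then have "r \<le> 1 + \<epsilon>\<^sup>2 * (4 * exp (2 * a\<^sup>2) + 2 * V)"
      using zero_le_power2[of \<epsilon>] by linarith
    then show ?thesis unfolding real by (rule ennreal_leI)
  next
    case top
    with I show ?thesis by (simp add: top_unique)
  qed
  then have "tv_dist (\<Pi>\<^sub>M i\<in>{1..n}. gauss 0) (\<Pi>\<^sub>M i\<in>{1..n}. density (gauss 0) f)
    \<le> sqrt (exp (real (card {1..n}) * (\<epsilon>\<^sup>2 * (4 * exp (2 * a\<^sup>2) + 2 * V))) - 1 + 2 * real (card {1..n}) * (\<epsilon> * b))"
    using h_ge hn V(2)
    by (intro tv_dist_PiM_density_le[where h = h] prob_space_gauss Qp) (auto simp: f_eq)
  then show ?thesis by (simp add: H0_eq H1_eq_PiM Q)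
qed

end

section \<open>Integrals against Gaussian densities and scaled distributions\<close>

text \<open>A distribution function determines its law, so the scale hypothesis turns integrals
  against the scaled law into integrals against g.\<close>

lemma scaled_measure_eq_distr:
  fixes G :: "real measure"
  assumes G: "prob_space G" "sets G = sets borel" and Gs: "real_distribution Gs" and s: "0 < s"
    and scale: "\<And>\<mu>. cdf Gs \<mu> = cdf G (\<mu> / s)"
  shows "Gs = distr G borel (\<lambda>\<theta>. s * \<theta>)"
proof (rule cdf_unique[OF Gs])
  interpret G: prob_space G by fact
  have [measurable]: "(\<lambda>\<theta>. s * \<theta>) \<in> measurable G borel"
    using G(2) by (simp cong: measurable_cong_sets)
  show "real_distribution (distr G borel (\<lambda>\<theta>. s * \<theta>))"
    by (intro G.real_distribution_distr) measurable
  have "cdf (distr G borel (\<lambda>\<theta>. s * \<theta>)) \<mu> = cdf G (\<mu> / s)" for \<mu>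
  proof -
    have "(\<lambda>\<theta>. s * \<theta>) -` {..\<mu>} \<inter> space G = {..\<mu> / s}"
      using s sets_eq_imp_space_eq[OF G(2)] by (auto simp: field_simps)
    then show ?thesis by (simp add: cdf_def measure_distr)
  qed
  then show "cdf Gs = cdf (distr G borel (\<lambda>\<theta>. s * \<theta>))" by (auto simp: scale)
qed

lemma nn_integral_gaussian:
  assumes "0 < a"
  shows "(\<integral>\<^sup>+\<theta>. ennreal (exp (- ((a * \<theta> - z)\<^sup>2 / 2))) \<partial>lborel) = ennreal (sqrt (2 * pi) / a)"
proof -
  have "ennreal (exp (- ((a * \<theta> - z)\<^sup>2 / 2)))
      = ennreal (sqrt (2 * pi) / a) * ennreal (normal_density (z / a) (1 / a) \<theta>)" for \<theta>
  proof -
    have "(a * \<theta> - z)\<^sup>2 / 2 = (\<theta> - z / a)\<^sup>2 / (2 * (1 / a)\<^sup>2)"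
      using assms by (simp add: field_simps power2_eq_square)
    moreover have "sqrt (2 * pi * (1 / a)\<^sup>2) = sqrt (2 * pi) / a"
      using assms by (simp add: real_sqrt_mult real_sqrt_divide power_divide)
    ultimately have "exp (- ((a * \<theta> - z)\<^sup>2 / 2)) = sqrt (2 * pi) / a * normal_density (z / a) (1 / a) \<theta>"
      using assms by (simp add: normal_density_def)
    then show ?thesis using assms by (simp add: ennreal_mult'[symmetric])
  qed
  then have "(\<integral>\<^sup>+\<theta>. ennreal (exp (- ((a * \<theta> - z)\<^sup>2 / 2))) \<partial>lborel)
      = ennreal (sqrt (2 * pi) / a) * (\<integral>\<^sup>+\<theta>. ennreal (normal_density (z / a) (1 / a) \<theta>) \<partial>lborel)"
    by (simp add: nn_integral_cmult)
  also have "(\<integral>\<^sup>+\<theta>. ennreal (normal_density (z / a) (1 / a) \<theta>) \<partial>lborel) = 1"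
    using prob_space.emeasure_space_1[OF prob_space_normal_density[of "1 / a" "z / a"]] assms
    by (simp add: emeasure_density)
  finally show ?thesis by simp
qed

lemma nn_integral_two_sided_le:
  fixes f :: "real \<Rightarrow> ennreal"
  assumes [measurable]: "f \<in> borel_measurable borel"
  shows "(\<integral>\<^sup>+x. f \<bar>x\<bar> * indicator {x. t < \<bar>x\<bar>} x \<partial>lborel) \<le> 2 * (\<integral>\<^sup>+x. f x * indicator {t..} x \<partial>lborel)"
proof -
  let ?f = "\<lambda>x. f x * indicator {t..} x"
  have "(\<integral>\<^sup>+x. f \<bar>x\<bar> * indicator {x. t < \<bar>x\<bar>} x \<partial>lborel)
      \<le> (\<integral>\<^sup>+x. ?f x + ?f (0 + (- 1) * x) \<partial>lborel)"
    by (intro nn_integral_mono) (auto simp: indicator_def abs_if)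
  also have "\<dots> = (\<integral>\<^sup>+x. ?f x \<partial>lborel) + (\<integral>\<^sup>+x. ?f (0 + (- 1) * x) \<partial>lborel)"
    by (rule nn_integral_add) measurable
  \<comment> \<open>The reflection is spelled as \<open>0 + (- 1) * x\<close> to match the affine
    substitution rule, whose Jacobian factor is |-1| = 1.\<close>
  also have "(\<integral>\<^sup>+x. ?f (0 + (- 1) * x) \<partial>lborel) = (\<integral>\<^sup>+x. ?f x \<partial>lborel)"
    using nn_integral_real_affine[of ?f "- 1" 0] by simp
  finally show ?thesis by (simp only: mult_2)
qed

lemma nn_integral_two_sided_exp_tail:
  "(\<integral>\<^sup>+x. ennreal (exp (- (\<bar>x\<bar> - t))) * indicator {x. t < \<bar>x\<bar>} x \<partial>lborel) \<le> 2"
  using nn_integral_two_sided_le[of "\<lambda>x. ennreal (exp (- (x - t)))" t] nn_integral_exp_tail[of 1 t] by simp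

lemma nn_integral_powr_tail:
  fixes y \<nu> :: real
  assumes "0 < y" "0 < \<nu>"
  shows "(\<integral>\<^sup>+x. ennreal (x powr (- \<nu> - 1)) * indicator {y..} x \<partial>lborel) = ennreal (y powr - \<nu> / \<nu>)"
proof -
  have "(\<integral>\<^sup>+x. ennreal (x powr (- \<nu> - 1)) * indicator {y..} x \<partial>lborel)
      = ennreal (0 - (- (y powr - \<nu>) / \<nu>))"
  proof (rule nn_integral_FTC_atLeast[where F = "\<lambda>x. - (x powr - \<nu>) / \<nu>"])
    show "((\<lambda>x. - (x powr - \<nu>) / \<nu>) \<longlongrightarrow> 0) at_top"
      using assms by real_asymp
    show "((\<lambda>x. - (x powr - \<nu>) / \<nu>) has_real_derivative x powr (- \<nu> - 1)) (at x)" if "y \<le> x" for x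
      using assms that by (auto intro!: derivative_eq_intros)
  qed auto
  then show ?thesis by simp
qed

lemma exp_diff_mult: "exp (a - b) = exp (- b) * exp (a::real)"
  by (simp add: mult_exp_exp)

section \<open>Gaussian integrals of functions with a pointwise exponential bound\<close>

context
  fixes f :: "real \<Rightarrow> ennreal" and K t :: real and W :: "real \<Rightarrow> real"
  assumes f[measurable]: "f \<in> borel_measurable borel" and K: "0 \<le> K" and t: "0 \<le> t"
    and f_le: "\<And>x. f x \<le> ennreal (K * exp (W \<bar>x\<bar>))"
begin

text \<open>The hypothesis on W puts the maximum of the weighted square at the end point |x| = t, so
  the integral is at most the length 2 t times that value.\<close>

lemma truncated_second_moment_le:
  assumes W: "\<And>y. 0 \<le> y \<Longrightarrow> y \<le> t \<Longrightarrow> 2 * W y - y\<^sup>2 / 2 \<le> 2 * W t - t\<^sup>2 / 2"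
  shows "(\<integral>\<^sup>+x. (f x)\<^sup>2 * indicator {x. \<bar>x\<bar> \<le> t} x \<partial>gauss 0)
    \<le> ennreal (2 * t * (K\<^sup>2 * exp (2 * W t - t\<^sup>2 / 2)))"
proof -
  have "(\<integral>\<^sup>+x. (f x)\<^sup>2 * indicator {x. \<bar>x\<bar> \<le> t} x \<partial>gauss 0)
      = (\<integral>\<^sup>+x. ennreal (std_normal_density x) * ((f x)\<^sup>2 * indicator {x. \<bar>x\<bar> \<le> t} x) \<partial>lborel)"
    by (rule nn_integral_gauss) measurable
  also have "\<dots> \<le> (\<integral>\<^sup>+x. ennreal (K\<^sup>2 * exp (2 * W t - t\<^sup>2 / 2)) * indicator {-t..t} x \<partial>lborel)"
  proof (rule nn_integral_mono)
    fix x :: real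
    have "ennreal (std_normal_density x) * (f x)\<^sup>2 \<le> ennreal (K\<^sup>2 * exp (2 * W t - t\<^sup>2 / 2))" if x: "\<bar>x\<bar> \<le> t"
    proof -
      have "ennreal (std_normal_density x) * (f x)\<^sup>2
          \<le> ennreal (exp (- (x\<^sup>2 / 2))) * (ennreal (K * exp (W \<bar>x\<bar>)))\<^sup>2"
        by (intro mult_mono power_mono f_le ennreal_leI std_normal_density_le) auto
      also have "\<dots> = ennreal (exp (- (x\<^sup>2 / 2)) * (K * exp (W \<bar>x\<bar>))\<^sup>2)"
        using K by (simp add: ennreal_power ennreal_mult''[symmetric])
      also have "exp (- (x\<^sup>2 / 2)) * (K * exp (W \<bar>x\<bar>))\<^sup>2 = K\<^sup>2 * exp (2 * W \<bar>x\<bar> - \<bar>x\<bar>\<^sup>2 / 2)"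
        by (simp add: power_mult_distrib exp_double exp_diff_mult)
      also have "\<dots> \<le> K\<^sup>2 * exp (2 * W t - t\<^sup>2 / 2)"
        using W[of "\<bar>x\<bar>"] x by (intro mult_left_mono) auto
      finally show ?thesis by (simp add: ennreal_leI)
    qed
    then show "ennreal (std_normal_density x) * ((f x)\<^sup>2 * indicator {x. \<bar>x\<bar> \<le> t} x)
        \<le> ennreal (K\<^sup>2 * exp (2 * W t - t\<^sup>2 / 2)) * indicator {-t..t} x"
      by (auto simp: indicator_def)
  qed
  also have "\<dots> = ennreal (2 * t * (K\<^sup>2 * exp (2 * W t - t\<^sup>2 / 2)))"
    using t by (subst nn_integral_cmult_indicator) (simp_all add: ennreal_mult''[symmetric] mult.commute)
  finally show ?thesis .
qed

text \<open>Beyond t the weighted exponent falls at least as fast as a line of slope -1, so the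
  value at t controls the two-sided tail up to a factor 2.\<close>

lemma tail_mean_le:
  assumes W: "\<And>y. t \<le> y \<Longrightarrow> W y - y\<^sup>2 / 2 \<le> W t - t\<^sup>2 / 2 - (y - t)"
  shows "(\<integral>\<^sup>+x. f x * indicator {x. t < \<bar>x\<bar>} x \<partial>gauss 0) \<le> ennreal (2 * K * exp (W t - t\<^sup>2 / 2))"
proof -
  let ?c = "K * exp (W t - t\<^sup>2 / 2)"
  have "(\<integral>\<^sup>+x. f x * indicator {x. t < \<bar>x\<bar>} x \<partial>gauss 0)
      = (\<integral>\<^sup>+x. ennreal (std_normal_density x) * (f x * indicator {x. t < \<bar>x\<bar>} x) \<partial>lborel)"
    by (rule nn_integral_gauss) measurable
  also have "\<dots> \<le> (\<integral>\<^sup>+x. ennreal ?c * (ennreal (exp (- (\<bar>x\<bar> - t))) * indicator {x. t < \<bar>x\<bar>} x) \<partial>lborel)"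
  proof (rule nn_integral_mono)
    fix x :: real
    have "ennreal (std_normal_density x) * f x \<le> ennreal ?c * ennreal (exp (- (\<bar>x\<bar> - t)))" if x: "t < \<bar>x\<bar>"
    proof -
      have "ennreal (std_normal_density x) * f x \<le> ennreal (exp (- (x\<^sup>2 / 2))) * ennreal (K * exp (W \<bar>x\<bar>))"
        by (intro mult_mono f_le ennreal_leI std_normal_density_le) auto
      also have "\<dots> = ennreal (K * exp (W \<bar>x\<bar> - \<bar>x\<bar>\<^sup>2 / 2))"
        using K by (simp add: ennreal_mult''[symmetric] exp_diff_mult mult_ac)
      also have "\<dots> \<le> ennreal (K * exp (W t - t\<^sup>2 / 2 - (\<bar>x\<bar> - t)))"
        using W[of "\<bar>x\<bar>"] x K by (intro ennreal_leI mult_left_mono) auto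
      also have "K * exp (W t - t\<^sup>2 / 2 - (\<bar>x\<bar> - t)) = ?c * exp (- (\<bar>x\<bar> - t))"
        by (simp only: mult.assoc exp_add[symmetric]) (simp add: algebra_simps)
      finally show ?thesis using K by (simp add: ennreal_mult'')
    qed
    then show "ennreal (std_normal_density x) * (f x * indicator {x. t < \<bar>x\<bar>} x)
        \<le> ennreal ?c * (ennreal (exp (- (\<bar>x\<bar> - t))) * indicator {x. t < \<bar>x\<bar>} x)"
      by (auto simp: indicator_def)
  qed
  also have "\<dots> = ennreal ?c * (\<integral>\<^sup>+x. ennreal (exp (- (\<bar>x\<bar> - t))) * indicator {x. t < \<bar>x\<bar>} x \<partial>lborel)"
    by (rule nn_integral_cmult) measurable
  also have "\<dots> \<le> ennreal ?c * 2"
    by (intro mult_left_mono nn_integral_two_sided_exp_tail) auto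
  also have "\<dots> = ennreal (2 * K * exp (W t - t\<^sup>2 / 2))"
    using K by (simp add: ennreal_mult''[symmetric] mult_ac flip: ennreal_numeral)
  finally show ?thesis .
qed

end

text \<open>Each tilt exp (mu * x - mu^2 / 2) has mean one under N(0, 1), so Tonelli's theorem
  leaves only the mass that G gives to large means.\<close>

lemma nn_integral_tail_ratio:
  assumes G: "real_distribution G"
  shows "(\<integral>\<^sup>+x. tail_ratio G a x \<partial>gauss 0) = emeasure G {\<mu>. a < \<bar>\<mu>\<bar>}"
proof -
  interpret G: real_distribution G by fact
  interpret P: prob_space "gauss 0" by (rule prob_space_gauss)
  interpret pair_sigma_finite G "gauss 0" ..
  have "(\<integral>\<^sup>+x. tail_ratio G a x \<partial>gauss 0)
      = (\<integral>\<^sup>+\<mu>. \<integral>\<^sup>+x. ennreal (exp (\<mu> * x - \<mu>\<^sup>2 / 2)) * indicator {\<mu>. a < \<bar>\<mu>\<bar>} \<mu> \<partial>gauss 0 \<partial>G)"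
    unfolding tail_ratio_def by (rule Fubini') measurable
  also have "\<dots> = (\<integral>\<^sup>+\<mu>. indicator {\<mu>. a < \<bar>\<mu>\<bar>} \<mu> \<partial>G)"
  proof (rule nn_integral_cong)
    fix \<mu> :: real
    have "(\<integral>\<^sup>+x. ennreal (exp (\<mu> * x - \<mu>\<^sup>2 / 2)) \<partial>gauss 0)
        = (\<integral>\<^sup>+x. ennreal (exp (- (\<mu>\<^sup>2 / 2))) * ennreal (exp (\<mu> * x)) \<partial>gauss 0)"
      by (intro nn_integral_cong) (simp add: ennreal_mult''[symmetric] exp_diff_mult mult_ac)
    also have "\<dots> = 1"
      by (subst nn_integral_cmult)
        (auto simp only: nn_integral_exp_gauss, auto simp: ennreal_mult''[symmetric] exp_minus)
    finally show "(\<integral>\<^sup>+x. ennreal (exp (\<mu> * x - \<mu>\<^sup>2 / 2)) * indicator {\<mu>. a < \<bar>\<mu>\<bar>} \<mu> \<partial>gauss 0)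
        = indicator {\<mu>. a < \<bar>\<mu>\<bar>} \<mu>"
      by (simp add: nn_integral_multc)
  qed
  finally show ?thesis by simp
qed

lemma eventually_at_top_linorder_ge:
  fixes P :: "real \<Rightarrow> bool"
  shows "eventually P at_top \<Longrightarrow> \<exists>T\<ge>N. \<forall>x\<ge>T. P x"
  unfolding eventually_at_top_linorder by (meson max.cobounded1 max.cobounded2 order_trans)

section \<open>Tail mass and likelihood contributions of a scaled distribution\<close>

context
  fixes G Gs :: "real measure" and g :: "real \<Rightarrow> real" and s :: real
  assumes g_meas[measurable]: "g \<in> borel_measurable borel" and g_nonneg: "\<And>\<theta>. 0 \<le> g \<theta>"
    and G_eq: "G = density lborel (\<lambda>\<theta>. ennreal (g \<theta>))" and G: "prob_space G"
    and Gs: "real_distribution Gs" and s: "0 < s"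
    and scale: "\<And>\<mu>. cdf Gs \<mu> = cdf G (\<mu> / s)"
begin

interpretation Gs: real_distribution Gs by (rule Gs)

lemma nn_integral_scaled:
  assumes [measurable]: "f \<in> borel_measurable borel"
  shows "(\<integral>\<^sup>+\<mu>. f \<mu> \<partial>Gs) = (\<integral>\<^sup>+\<theta>. ennreal (g \<theta>) * f (s * \<theta>) \<partial>lborel)"
proof -
  have "Gs = distr G borel (\<lambda>\<theta>. s * \<theta>)"
    by (rule scaled_measure_eq_distr[OF G _ Gs s scale]) (simp add: G_eq)
  then show ?thesis
    by (simp add: G_eq nn_integral_distr nn_integral_density)
qed

text \<open>Mass is collected from a window of width w just above y. For polynomial tails w is of
  the order of y itself, for the faster tails w = 1.\<close>

lemma scaled_tail_ge:
  assumes "m \<le> s * y" "0 \<le> c" "0 \<le> w" and c: "\<And>\<theta>. y < \<theta> \<Longrightarrow> \<theta> < y + w \<Longrightarrow> c \<le> g \<theta>"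
  shows "c * w \<le> measure Gs {m<..}"
proof -
  have "ennreal (c * w) = (\<integral>\<^sup>+\<theta>. ennreal c * indicator {y<..<y + w} \<theta> \<partial>lborel)"
    using assms by (subst nn_integral_cmult_indicator) (simp_all add: ennreal_mult')
  also have "\<dots> \<le> (\<integral>\<^sup>+\<theta>. ennreal (g \<theta>) * indicator {m<..} (s * \<theta>) \<partial>lborel)"
  proof (rule nn_integral_mono)
    fix \<theta> :: real
    have "m < s * \<theta>" if "y < \<theta>" using assms(1) s that by (meson le_less_trans mult_less_cancel_left_pos)
    then show "ennreal c * indicator {y<..<y + w} \<theta> \<le> ennreal (g \<theta>) * indicator {m<..} (s * \<theta>)"
      using c[of \<theta>] by (auto simp: indicator_def intro: ennreal_leI)
  qed
  also have "\<dots> = emeasure Gs {m<..}"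
    by (subst nn_integral_scaled[symmetric]) auto
  finally show ?thesis by (simp add: Gs.emeasure_eq_measure)
qed

lemma scaled_powr_tail_le:
  assumes \<nu>: "0 < \<nu>" and a: "0 < a" and C: "0 \<le> C"
    and g_le: "\<And>\<theta>. a < s * \<bar>\<theta>\<bar> \<Longrightarrow> g \<theta> \<le> C * \<bar>\<theta>\<bar> powr (- \<nu> - 1)"
  shows "emeasure Gs {\<mu>. a < \<bar>\<mu>\<bar>} \<le> ennreal (2 * C / \<nu> * (a / s) powr - \<nu>)"
proof -
  let ?f = "\<lambda>x::real. ennreal (x powr (- \<nu> - 1))"
  have "emeasure Gs {\<mu>. a < \<bar>\<mu>\<bar>} = (\<integral>\<^sup>+\<theta>. ennreal (g \<theta>) * indicator {\<mu>. a < \<bar>\<mu>\<bar>} (s * \<theta>) \<partial>lborel)"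
    by (subst nn_integral_scaled[symmetric]) auto
  also have "\<dots> \<le> (\<integral>\<^sup>+\<theta>. ennreal C * (?f \<bar>\<theta>\<bar> * indicator {x. a / s < \<bar>x\<bar>} \<theta>) \<partial>lborel)"
  proof (rule nn_integral_mono)
    fix \<theta> :: real
    show "ennreal (g \<theta>) * indicator {\<mu>. a < \<bar>\<mu>\<bar>} (s * \<theta>)
        \<le> ennreal C * (?f \<bar>\<theta>\<bar> * indicator {x. a / s < \<bar>x\<bar>} \<theta>)"
      using g_le[of \<theta>] s C
      by (auto simp: indicator_def abs_mult field_simps ennreal_mult'[symmetric] intro!: ennreal_leI)
  qed
  also have "\<dots> = ennreal C * (\<integral>\<^sup>+\<theta>. ?f \<bar>\<theta>\<bar> * indicator {x. a / s < \<bar>x\<bar>} \<theta> \<partial>lborel)"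
    by (rule nn_integral_cmult) measurable
  also have "\<dots> \<le> ennreal C * (2 * (\<integral>\<^sup>+x. ?f x * indicator {a / s..} x \<partial>lborel))"
    by (intro mult_left_mono nn_integral_two_sided_le) auto
  also have "\<dots> = ennreal C * (2 * ennreal ((a / s) powr - \<nu> / \<nu>))"
    using nn_integral_powr_tail[of "a / s" \<nu>] a s \<nu> by simp
  also have "2 * ennreal ((a / s) powr - \<nu> / \<nu>) = ennreal (2 * ((a / s) powr - \<nu> / \<nu>))"
    using \<nu> by (subst ennreal_mult') simp_all
  also have "ennreal C * \<dots> = ennreal (2 * C / \<nu> * (a / s) powr - \<nu>)"
    using C \<nu> by (simp add: ennreal_mult'[symmetric] mult_ac)
  finally show ?thesis .
qed

text \<open>The hypothesis is a bound with the square already completed, in which z may depend on x.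
  Replacing |\<theta>| by both signs gives two Gaussian integrals centred at z / k and - z / k, each
  equal to sqrt (2 pi) / k.\<close>

lemma tail_ratio_le_gaussian:
  assumes C: "0 \<le> C" and k: "0 < k"
    and g_le: "\<And>\<theta>. a < s * \<bar>\<theta>\<bar> \<Longrightarrow>
      g \<theta> * exp (s * \<theta> * x - (s * \<theta>)\<^sup>2 / 2) \<le> C * exp (z\<^sup>2 / 2 - (k * \<bar>\<theta>\<bar> - z)\<^sup>2 / 2)"
  shows "tail_ratio Gs a x \<le> ennreal (2 * C * sqrt (2 * pi) / k * exp (z\<^sup>2 / 2))"
proof -
  let ?c = "C * exp (z\<^sup>2 / 2)"
  let ?f = "\<lambda>y \<theta>. ennreal (exp (- ((k * \<theta> - y)\<^sup>2 / 2)))"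
  have "tail_ratio Gs a x = (\<integral>\<^sup>+\<theta>. ennreal (g \<theta>) *
      (ennreal (exp (s * \<theta> * x - (s * \<theta>)\<^sup>2 / 2)) * indicator {\<mu>. a < \<bar>\<mu>\<bar>} (s * \<theta>)) \<partial>lborel)"
    unfolding tail_ratio_def by (subst nn_integral_scaled) auto
  also have "\<dots> \<le> (\<integral>\<^sup>+\<theta>. ennreal ?c * (?f z \<theta> + ?f (- z) \<theta>) \<partial>lborel)"
  proof (rule nn_integral_mono)
    fix \<theta> :: real
    have "g \<theta> * exp (s * \<theta> * x - (s * \<theta>)\<^sup>2 / 2)
        \<le> ?c * (exp (- ((k * \<theta> - z)\<^sup>2 / 2)) + exp (- ((k * \<theta> - (- z))\<^sup>2 / 2)))" if "a < s * \<bar>\<theta>\<bar>"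
    proof -
      have "exp (- ((k * \<bar>\<theta>\<bar> - z)\<^sup>2 / 2)) \<le> exp (- ((k * \<theta> - z)\<^sup>2 / 2)) + exp (- ((k * \<theta> - (- z))\<^sup>2 / 2))"
      proof (cases "0 \<le> \<theta>")
        case False
        then have "(k * \<bar>\<theta>\<bar> - z)\<^sup>2 = (k * \<theta> - (- z))\<^sup>2" by (simp add: power2_eq_square algebra_simps)
        then show ?thesis by simp
      qed simp
      then have "?c * exp (- ((k * \<bar>\<theta>\<bar> - z)\<^sup>2 / 2))
          \<le> ?c * (exp (- ((k * \<theta> - z)\<^sup>2 / 2)) + exp (- ((k * \<theta> - (- z))\<^sup>2 / 2)))"
        using C by (intro mult_left_mono) auto
      moreover have "?c * exp (- ((k * \<bar>\<theta>\<bar> - z)\<^sup>2 / 2)) = C * exp (z\<^sup>2 / 2 - (k * \<bar>\<theta>\<bar> - z)\<^sup>2 / 2)"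
        by (simp add: exp_diff_mult)
      ultimately show ?thesis using g_le[OF that] by linarith
    qed
    then show "ennreal (g \<theta>) * (ennreal (exp (s * \<theta> * x - (s * \<theta>)\<^sup>2 / 2)) * indicator {\<mu>. a < \<bar>\<mu>\<bar>} (s * \<theta>))
        \<le> ennreal ?c * (?f z \<theta> + ?f (- z) \<theta>)"
      using s C g_nonneg[of \<theta>]
      by (auto simp: indicator_def abs_mult ennreal_mult'[symmetric] simp flip: ennreal_plus intro!: ennreal_leI)
  qed
  also have "\<dots> = ennreal ?c * (ennreal (sqrt (2 * pi) / k) + ennreal (sqrt (2 * pi) / k))"
    using nn_integral_gaussian[OF k, of "- z"]
    by (subst nn_integral_cmult) (simp_all add: nn_integral_add nn_integral_gaussian[OF k])
  also have "\<dots> = ennreal (?c * (sqrt (2 * pi) / k + sqrt (2 * pi) / k))"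
    using C k by (simp add: ennreal_mult'[symmetric] flip: ennreal_plus)
  also have "?c * (sqrt (2 * pi) / k + sqrt (2 * pi) / k) = 2 * C * sqrt (2 * pi) / k * exp (z\<^sup>2 / 2)"
    by (simp add: mult_ac)
  finally show ?thesis .
qed

end

section \<open>Limits of the total variation distance\<close>

lemma tv_dist_H0_H1_nonneg: "0 \<le> \<beta> \<Longrightarrow> 1 \<le> n \<Longrightarrow> real_distribution (Gn n) \<Longrightarrow> 0 \<le> tv_dist (H0 n) (H1 Gn \<beta> n)"
  by (rule tv_dist_nonneg[OF prob_space_H0 prob_space_H1 sets_H1])

lemma tv_dist_H0_H1_le_1: "0 \<le> \<beta> \<Longrightarrow> 1 \<le> n \<Longrightarrow> real_distribution (Gn n) \<Longrightarrow> tv_dist (H0 n) (H1 Gn \<beta> n) \<le> 1"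
  by (rule tv_dist_le_1[OF prob_space_H0 prob_space_H1 sets_H1])

text \<open>The infimum ranges over \<beta> <= 1. If b < 1 it is approached from above, but for b =
  1 no larger \<beta> is admissible, and convergence is required at \<beta> = 1 itself.\<close>

lemma critical_sparsity_levelI:
  assumes b: "0 < b" "b \<le> 1"
    and to_1: "\<And>\<beta>. 0 \<le> \<beta> \<Longrightarrow> \<beta> < b \<Longrightarrow> (\<lambda>n. tv_dist (H0 n) (H1 Gn \<beta> n)) \<longlonglongrightarrow> 1"
    and to_0: "\<And>\<beta>. b < \<beta> \<Longrightarrow> (\<lambda>n. tv_dist (H0 n) (H1 Gn \<beta> n)) \<longlonglongrightarrow> 0"
    and to_0': "b = 1 \<Longrightarrow> (\<lambda>n. tv_dist (H0 n) (H1 Gn 1 n)) \<longlonglongrightarrow> 0"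
  shows "critical_sparsity_level Gn b"
  unfolding critical_sparsity_level_def
proof
  let ?T = "\<lambda>\<beta> n. tv_dist (H0 n) (H1 Gn \<beta> n)"
  have not_1: "\<not> ?T \<beta> \<longlonglongrightarrow> 1" if "b < \<beta>" for \<beta>
    using LIMSEQ_unique[OF to_0[OF that], of 1] by auto
  have not_0: "\<not> ?T \<beta> \<longlonglongrightarrow> 0" if "0 \<le> \<beta>" "\<beta> < b" for \<beta>
    using LIMSEQ_unique[OF to_1[OF that], of 0] by auto
  show "lower_critical Gn = ereal b"
    unfolding lower_critical_def
  proof (rule Sup_eqI)
    fix y assume "y \<in> ereal ` {\<beta>. 0 \<le> \<beta> \<and> ?T \<beta> \<longlonglongrightarrow> 1}"
    then show "y \<le> ereal b" using not_1 by (force simp: not_le[symmetric])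
  next
    fix y assume y: "\<And>z. z \<in> ereal ` {\<beta>. 0 \<le> \<beta> \<and> ?T \<beta> \<longlonglongrightarrow> 1} \<Longrightarrow> z \<le> y"
    have *: "ereal \<beta> \<le> y" if "0 \<le> \<beta>" "\<beta> < b" for \<beta>
      using to_1[OF that] that by (intro y) auto
    show "ereal b \<le> y"
    proof (rule ccontr)
      assume "\<not> ereal b \<le> y"
      then have "y < ereal b" by simp
      then obtain \<beta> where \<beta>: "y < ereal \<beta>" "ereal \<beta> < ereal b" using ereal_dense2 by blast
      \<comment> \<open>The bound y may a priori be minus infinity; comparing it with \<beta> = 0
        ensures that the intermediate \<beta> is not negative.\<close>
      have "ereal 0 \<le> y" using * b by simp
      then have "0 \<le> \<beta>" using \<beta>(1) by (metis ereal_less_eq(3) le_less_trans less_imp_le)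
      then show False using *[of \<beta>] \<beta> by simp
    qed
  qed
  show "upper_critical Gn = ereal b"
    unfolding upper_critical_def
  proof (rule Inf_eqI)
    fix y assume "y \<in> ereal ` {\<beta>. 0 \<le> \<beta> \<and> \<beta> \<le> 1 \<and> ?T \<beta> \<longlonglongrightarrow> 0}"
    then show "ereal b \<le> y" using not_0 by (force simp: not_le[symmetric])
  next
    fix y assume y: "\<And>z. z \<in> ereal ` {\<beta>. 0 \<le> \<beta> \<and> \<beta> \<le> 1 \<and> ?T \<beta> \<longlonglongrightarrow> 0} \<Longrightarrow> y \<le> z"
    show "y \<le> ereal b"
    proof (cases "b = 1")
      case True
      then show ?thesis using to_0' by (intro y) auto
    next
      case False
      have *: "y \<le> ereal \<beta>" if "b < \<beta>" "\<beta> \<le> 1" for \<beta>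
        using to_0[OF that(1)] that b by (intro y) auto
      show ?thesis
      proof (rule ccontr)
        assume "\<not> y \<le> ereal b"
        then have "ereal b < y" by simp
        \<comment> \<open>The minimum with 1 keeps the intermediate \<beta> in the admissible
          range.\<close>
        then have "ereal b < min y 1" using False b by simp
        then obtain \<beta> where \<beta>: "ereal b < ereal \<beta>" "ereal \<beta> < min y 1" using ereal_dense2 by blast
        then have "ereal \<beta> < y" "y \<le> ereal \<beta>" using *[of \<beta>] by auto
        then show False by simp
      qed
    qed
  qed
qed

text \<open>The expression equals n^(1 - 2 \<beta>); this is the source of the requirement \<beta> >
  1/2.\<close>

lemma sample_size_weight_squared_tendsto_0:
  fixes \<beta> :: real
  assumes "1 / 2 < \<beta>"
  shows "(\<lambda>n. real n * (real n powr - \<beta>)\<^sup>2) \<longlonglongrightarrow> 0"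
proof (rule Lim_transform_eventually)
  show "(\<lambda>n. real n powr (1 - 2 * \<beta>)) \<longlonglongrightarrow> 0" using assms by real_asymp
  show "\<forall>\<^sub>F n in sequentially. real n powr (1 - 2 * \<beta>) = real n * (real n powr - \<beta>)\<^sup>2"
    using eventually_gt_at_top[of 0]
  proof eventually_elim
    case (elim n)
    have "real n powr (1 - 2 * \<beta>) = real n powr 1 * (real n powr - \<beta> * real n powr - \<beta>)"
      by (simp only: powr_add[symmetric]) simp
    then show ?case using elim by (simp add: power2_eq_square)
  qed
qed

section \<open>Asymptotic criteria for the two limits of the distance\<close>

context
  fixes \<beta> :: real and Gn :: "nat \<Rightarrow> real measure"
  assumes Gn: "\<And>n. real_distribution (Gn n)"
begin

text \<open>With t = sqrt (2 ln n) one has n * exp (- t^2 / 2) = 1, so the error under H0 is at most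
  1 / t. The error under H1 vanishes once the lower bound on the expected number of exceedances
  diverges.\<close>

lemma tv_dist_tendsto_1:
  assumes \<beta>: "0 \<le> \<beta>" and m: "\<forall>\<^sub>F n in sequentially. m n \<le> sqrt (2 * ln n)"
    and c: "\<forall>\<^sub>F n in sequentially. c n \<le> measure (Gn n) {m n<..}"
    and lim: "filterlim (\<lambda>n. real n powr (1 - \<beta>) * (c n * std_normal_density (sqrt (2 * ln n) - m n + 1)))
      at_top sequentially"
  shows "(\<lambda>n. tv_dist (H0 n) (H1 Gn \<beta> n)) \<longlonglongrightarrow> 1"
proof (rule tendsto_sandwich)
  let ?t = "\<lambda>n::nat. sqrt (2 * ln (real n))"
  let ?X = "\<lambda>n. real n powr (1 - \<beta>) * (c n * std_normal_density (?t n - m n + 1))"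
  show "\<forall>\<^sub>F n in sequentially. 1 - 1 / ?t n - exp (- ?X n) \<le> tv_dist (H0 n) (H1 Gn \<beta> n)"
    using m c eventually_ge_at_top[of 2]
  proof eventually_elim
    case (elim n)
    have n: "1 \<le> n" "0 < ?t n" "(?t n)\<^sup>2 = 2 * ln n" using elim by auto
    have e: "exp (- ((?t n)\<^sup>2 / 2)) = 1 / real n"
      using n by (simp add: exp_minus inverse_eq_divide)
    have p: "real n powr (1 - \<beta>) = real n * real n powr - \<beta>"
      using n by (simp add: powr_diff powr_minus divide_inverse)
    have "?X n \<le> real n * (real n powr - \<beta> * (measure (Gn n) {m n<..} * std_normal_density (?t n - m n + 1)))"
      unfolding p mult.assoc using elim(2) by (intro mult_left_mono mult_right_mono) auto
    then have "exp (- (real n * (real n powr - \<beta> * (measure (Gn n) {m n<..} * std_normal_density (?t n - m n + 1)))))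
        \<le> exp (- ?X n)" by simp
    moreover have "real n * (exp (- ((?t n)\<^sup>2 / 2)) / ?t n) = 1 / ?t n"
      unfolding e using n by simp
    ultimately show ?case
      using tv_dist_ge[where Gn = Gn, OF \<beta> n(1) Gn n(2) elim(1)] by linarith
  qed
  show "\<forall>\<^sub>F n in sequentially. tv_dist (H0 n) (H1 Gn \<beta> n) \<le> 1"
    using eventually_ge_at_top[of 1] by eventually_elim (intro tv_dist_H0_H1_le_1 \<beta> Gn)
  have "(\<lambda>n::nat. 1 / ?t n) \<longlonglongrightarrow> 0" by real_asymp
  moreover have "(\<lambda>n. exp (- ?X n)) \<longlonglongrightarrow> 0"
    using lim by (intro filterlim_compose[OF exp_at_bot]) (simp add: filterlim_uminus_at_top)
  ultimately have "(\<lambda>n. 1 - 1 / ?t n - exp (- ?X n)) \<longlonglongrightarrow> 1 - 0 - 0"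
    by (intro tendsto_intros)
  then show "(\<lambda>n. 1 - 1 / ?t n - exp (- ?X n)) \<longlonglongrightarrow> 1" by simp
qed simp

lemma tv_dist_tendsto_0:
  assumes \<beta>: "1 / 2 < \<beta>" and a: "0 \<le> a"
    and b: "\<forall>\<^sub>F n in sequentially. 0 \<le> b n \<and>
      (\<integral>\<^sup>+x. tail_ratio (Gn n) a x * indicator {x. t n < \<bar>x\<bar>} x \<partial>gauss 0) \<le> ennreal (b n)"
    and V: "\<forall>\<^sub>F n in sequentially. 0 \<le> V n \<and>
      (\<integral>\<^sup>+x. (tail_ratio (Gn n) a x)\<^sup>2 * indicator {x. \<bar>x\<bar> \<le> t n} x \<partial>gauss 0) \<le> ennreal (V n)"
    and lim_b: "(\<lambda>n. real n * (real n powr - \<beta> * b n)) \<longlonglongrightarrow> 0"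
    and lim_V: "(\<lambda>n. real n * ((real n powr - \<beta>)\<^sup>2 * V n)) \<longlonglongrightarrow> 0"
  shows "(\<lambda>n. tv_dist (H0 n) (H1 Gn \<beta> n)) \<longlonglongrightarrow> 0"
proof (rule tendsto_sandwich)
  let ?B = "\<lambda>n. sqrt (exp (4 * exp (2 * a\<^sup>2) * (real n * (real n powr - \<beta>)\<^sup>2)
    + 2 * (real n * ((real n powr - \<beta>)\<^sup>2 * V n))) - 1 + 2 * (real n * (real n powr - \<beta> * b n)))"
  have \<beta>0: "0 \<le> \<beta>" using \<beta> by simp
  show "\<forall>\<^sub>F n in sequentially. 0 \<le> tv_dist (H0 n) (H1 Gn \<beta> n)"
    using eventually_ge_at_top[of 1] by eventually_elim (intro tv_dist_H0_H1_nonneg \<beta>0 Gn)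
  show "\<forall>\<^sub>F n in sequentially. tv_dist (H0 n) (H1 Gn \<beta> n) \<le> ?B n"
    using b V eventually_ge_at_top[of 1]
  proof eventually_elim
    case (elim n)
    then show ?case
      using tv_dist_le[where a = a and \<beta> = \<beta> and n = n and Gn = Gn and t = "t n" and b = "b n" and V = "V n"] \<beta>0 a Gn
      by (simp add: algebra_simps)
  qed
  have "?B \<longlonglongrightarrow> sqrt (exp (4 * exp (2 * a\<^sup>2) * 0 + 2 * 0) - 1 + 2 * 0)"
    by (intro tendsto_intros sample_size_weight_squared_tendsto_0 \<beta> lim_b lim_V)
  then show "?B \<longlonglongrightarrow> 0" by simp
qed simp

text \<open>Put R = K * exp (W t) * n^(-\<beta>). Because exp (- t^2 / 2) = 1 / n, the discarded
  mean contributes 2 R and the truncated second moment 2 t R^2. A single condition, (1 + t) * R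
  tending to 0, covers both.\<close>

lemma tv_dist_tendsto_0_of_pointwise_bound:
  fixes W :: "nat \<Rightarrow> real \<Rightarrow> real" and K :: "nat \<Rightarrow> real"
  defines "t \<equiv> \<lambda>n::nat. sqrt (2 * ln n)"
  assumes \<beta>: "1 / 2 < \<beta>" and a: "0 \<le> a"
    and K: "\<forall>\<^sub>F n in sequentially. 0 \<le> K n \<and> (\<forall>x. tail_ratio (Gn n) a x \<le> ennreal (K n * exp (W n \<bar>x\<bar>)))"
    and W1: "\<forall>\<^sub>F n in sequentially. \<forall>y. 0 \<le> y \<longrightarrow> y \<le> t n \<longrightarrow> 2 * W n y - y\<^sup>2 / 2 \<le> 2 * W n (t n) - (t n)\<^sup>2 / 2"
    and W2: "\<forall>\<^sub>F n in sequentially. \<forall>y. t n \<le> y \<longrightarrow> W n y - y\<^sup>2 / 2 \<le> W n (t n) - (t n)\<^sup>2 / 2 - (y - t n)"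
    and lim: "(\<lambda>n. (1 + t n) * (K n * exp (W n (t n)) * real n powr - \<beta>)) \<longlonglongrightarrow> 0"
  shows "(\<lambda>n. tv_dist (H0 n) (H1 Gn \<beta> n)) \<longlonglongrightarrow> 0"
proof (rule tv_dist_tendsto_0[OF \<beta> a])
  define R where "R n = K n * exp (W n (t n)) * real n powr - \<beta>" for n
  have t: "(t n)\<^sup>2 / 2 = ln n" "0 \<le> t n" if "1 \<le> n" for n :: nat
    using that by (simp_all add: t_def)
  show "\<forall>\<^sub>F n in sequentially. 0 \<le> 2 * K n * exp (W n (t n) - (t n)\<^sup>2 / 2) \<and>
      (\<integral>\<^sup>+x. tail_ratio (Gn n) a x * indicator {x. t n < \<bar>x\<bar>} x \<partial>gauss 0)
        \<le> ennreal (2 * K n * exp (W n (t n) - (t n)\<^sup>2 / 2))"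
    using K W2 eventually_ge_at_top[of 1]
  proof eventually_elim
    case (elim n)
    then show ?case
      using tail_mean_le[OF measurable_tail_ratio[OF Gn], where K = "K n" and W = "W n" and t = "t n"] t(2)[of n]
      by auto
  qed
  show "\<forall>\<^sub>F n in sequentially. 0 \<le> 2 * t n * ((K n)\<^sup>2 * exp (2 * W n (t n) - (t n)\<^sup>2 / 2)) \<and>
      (\<integral>\<^sup>+x. (tail_ratio (Gn n) a x)\<^sup>2 * indicator {x. \<bar>x\<bar> \<le> t n} x \<partial>gauss 0)
        \<le> ennreal (2 * t n * ((K n)\<^sup>2 * exp (2 * W n (t n) - (t n)\<^sup>2 / 2)))"
    using K W1 eventually_ge_at_top[of 1]
  proof eventually_elim
    case (elim n)
    then show ?case
      using truncated_second_moment_le[OF measurable_tail_ratio[OF Gn], where K = "K n" and W = "W n" and t = "t n"] t(2)[of n]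
      by auto
  qed
  have R0: "\<forall>\<^sub>F n in sequentially. 0 \<le> R n"
    using K by eventually_elim (simp add: R_def)
  have lim': "(\<lambda>n. (1 + t n) * R n) \<longlonglongrightarrow> 0" using lim by (simp add: R_def)
  show "(\<lambda>n. real n * (real n powr - \<beta> * (2 * K n * exp (W n (t n) - (t n)\<^sup>2 / 2)))) \<longlonglongrightarrow> 0"
  proof (rule tendsto_sandwich[OF _ _ tendsto_const])
    show "(\<lambda>n. 2 * ((1 + t n) * R n)) \<longlonglongrightarrow> 0" using tendsto_mult[OF tendsto_const[of 2] lim'] by simp
    have eq: "real n * (real n powr - \<beta> * (2 * K n * exp (W n (t n) - (t n)\<^sup>2 / 2))) = 2 * R n" if "1 \<le> n" for n
      using t[OF that] that by (simp add: R_def exp_diff)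
    show "\<forall>\<^sub>F n in sequentially. 0 \<le> real n * (real n powr - \<beta> * (2 * K n * exp (W n (t n) - (t n)\<^sup>2 / 2)))"
      using R0 eventually_ge_at_top[of 1] by eventually_elim (simp only: eq)
    show "\<forall>\<^sub>F n in sequentially. real n * (real n powr - \<beta> * (2 * K n * exp (W n (t n) - (t n)\<^sup>2 / 2))) \<le> 2 * ((1 + t n) * R n)"
      using R0 eventually_ge_at_top[of 1]
    proof eventually_elim
      case (elim n)
      have "0 \<le> t n * R n" using elim t(2)[of n] by simp
      then show ?case unfolding eq[OF elim(2)] by (simp add: distrib_right)
    qed
  qed
  show "(\<lambda>n. real n * ((real n powr - \<beta>)\<^sup>2 * (2 * t n * ((K n)\<^sup>2 * exp (2 * W n (t n) - (t n)\<^sup>2 / 2))))) \<longlonglongrightarrow> 0"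
  proof (rule tendsto_sandwich[OF _ _ tendsto_const])
    show "(\<lambda>n. 2 * ((1 + t n) * R n)\<^sup>2) \<longlonglongrightarrow> 0"
      using tendsto_mult[OF tendsto_const[of 2] tendsto_power[OF lim', of 2]] by simp
    have eq: "real n * ((real n powr - \<beta>)\<^sup>2 * (2 * t n * ((K n)\<^sup>2 * exp (2 * W n (t n) - (t n)\<^sup>2 / 2))))
        = 2 * (t n * (R n)\<^sup>2)" if "1 \<le> n" for n
      using t[OF that] that by (simp add: R_def exp_diff exp_double power_mult_distrib)
    show "\<forall>\<^sub>F n in sequentially. 0 \<le> real n * ((real n powr - \<beta>)\<^sup>2 * (2 * t n * ((K n)\<^sup>2 * exp (2 * W n (t n) - (t n)\<^sup>2 / 2))))"
      using eventually_ge_at_top[of 1] by eventually_elim (simp add: eq t(2))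
    show "\<forall>\<^sub>F n in sequentially. real n * ((real n powr - \<beta>)\<^sup>2 * (2 * t n * ((K n)\<^sup>2 * exp (2 * W n (t n) - (t n)\<^sup>2 / 2))))
        \<le> 2 * ((1 + t n) * R n)\<^sup>2"
      using eventually_ge_at_top[of 1]
    proof eventually_elim
      case (elim n)
      have "t n \<le> (1 + t n)\<^sup>2" using t(2)[OF elim] by (simp add: power2_eq_square algebra_simps)
      then show ?case unfolding eq[OF elim] power_mult_distrib by (simp add: mult_right_mono)
    qed
  qed
qed

end

section \<open>Explicit constants from Landau bounds, and asymptotics in ln n\<close>

lemma two_sided_boundE:
  fixes g h :: "real \<Rightarrow> real"
  assumes "g \<in> O(h)" "(\<lambda>\<theta>. g (- \<theta>)) \<in> O(h)" and g: "\<And>\<theta>. 0 \<le> g \<theta>" and h: "\<And>\<theta>. 0 \<le> h \<theta>"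
  obtains C T where "0 < C" "N \<le> T" "\<And>\<theta>. T \<le> \<bar>\<theta>\<bar> \<Longrightarrow> g \<theta> \<le> C * h \<bar>\<theta>\<bar>"
proof -
  obtain C1 where C1: "0 < C1" "\<forall>\<^sub>F \<theta> in at_top. norm (g \<theta>) \<le> C1 * norm (h \<theta>)"
    using assms(1) by (rule landau_o.bigE)
  obtain C2 where C2: "0 < C2" "\<forall>\<^sub>F \<theta> in at_top. norm (g (- \<theta>)) \<le> C2 * norm (h \<theta>)"
    using assms(2) by (rule landau_o.bigE)
  have "\<forall>\<^sub>F \<theta> in at_top. g \<theta> \<le> C1 * h \<theta> \<and> g (- \<theta>) \<le> C2 * h \<theta>"
    using C1(2) C2(2) by eventually_elim (simp add: g h)
  then obtain T where T: "N \<le> T" "\<And>\<theta>. T \<le> \<theta> \<Longrightarrow> g \<theta> \<le> C1 * h \<theta> \<and> g (- \<theta>) \<le> C2 * h \<theta>"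
    using eventually_at_top_linorder_ge[of _ N] by blast
  show ?thesis
  proof (rule that[of "C1 + C2" T])
    fix \<theta> :: real assume \<theta>: "T \<le> \<bar>\<theta>\<bar>"
    have "g \<theta> \<le> C1 * h \<bar>\<theta>\<bar> \<or> g \<theta> \<le> C2 * h \<bar>\<theta>\<bar>"
      using T(2)[OF \<theta>] by (cases "0 \<le> \<theta>") (auto simp: abs_if split: if_splits)
    moreover have "0 \<le> C1 * h \<bar>\<theta>\<bar>" "0 \<le> C2 * h \<bar>\<theta>\<bar>" using C1(1) C2(1) h by simp_all
    ultimately show "g \<theta> \<le> (C1 + C2) * h \<bar>\<theta>\<bar>" unfolding distrib_right by linarith
  qed (use C1(1) C2(1) T(1) in auto)
qed

lemma lower_boundE:
  fixes g h :: "real \<Rightarrow> real"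
  assumes "g \<in> \<Omega>(h)" and g: "\<And>\<theta>. 0 \<le> g \<theta>" and h: "\<And>\<theta>. 0 \<le> h \<theta>"
  obtains c T where "0 < c" "N \<le> T" "\<And>\<theta>. T \<le> \<theta> \<Longrightarrow> c * h \<theta> \<le> g \<theta>"
proof -
  obtain c where c: "0 < c" "\<forall>\<^sub>F \<theta> in at_top. norm (g \<theta>) \<ge> c * norm (h \<theta>)"
    using assms(1) by (rule landau_omega.bigE)
  have "\<forall>\<^sub>F \<theta> in at_top. c * h \<theta> \<le> g \<theta>"
    using c(2) by eventually_elim (simp add: g h)
  then obtain T where "N \<le> T" "\<And>\<theta>. T \<le> \<theta> \<Longrightarrow> c * h \<theta> \<le> g \<theta>"
    using eventually_at_top_linorder_ge[of _ N] by blast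
  with c(1) show ?thesis by (rule that)
qed

text \<open>The limit is taken in x = ln n, where the terms are x, sqrt x and a constant; p and q
  may have any sign, which absorbs all lower-order terms of the exponents.\<close>

lemma filterlim_ln_dominates:
  fixes \<delta> p q :: real
  assumes \<delta>: "0 < \<delta>"
  shows "filterlim (\<lambda>n::nat. \<delta> * ln n + p * sqrt (2 * ln n) + q) at_top sequentially"
proof -
  have "filterlim (\<lambda>x. \<delta> * x + p * sqrt (2 * x) + q) at_top at_top"
    using \<delta> by real_asymp
  moreover have "filterlim (\<lambda>n::nat. ln n) at_top sequentially" by real_asymp
  ultimately show ?thesis by (rule filterlim_compose)
qed

lemma exp_ln_dominates:
  fixes \<delta> p q c :: real
  assumes "0 < \<delta>" "0 < c"
  shows "filterlim (\<lambda>n::nat. c * exp (\<delta> * ln n + p * sqrt (2 * ln n) + q)) at_top sequentially"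
  by (rule filterlim_tendsto_pos_mult_at_top[OF tendsto_const \<open>0 < c\<close>
        filterlim_compose[OF exp_at_top filterlim_ln_dominates[OF \<open>0 < \<delta>\<close>]]])

text \<open>The first form serves Gaussian tails, where the prefactor \<open>K\<close> is constant;
  the second serves exponential tails, where \<open>K\<close> grows with 1 / \<sigma> n, hence like
  sqrt (2 ln n).\<close>

lemma exp_ln_vanishes:
  fixes \<delta> p q c :: real
  assumes \<delta>: "0 < \<delta>"
  shows "(\<lambda>n::nat. (1 + sqrt (2 * ln n)) * (c * exp (p * sqrt (2 * ln n) - \<delta> * ln n))) \<longlonglongrightarrow> 0"
    and "(\<lambda>n::nat. (1 + sqrt (2 * ln n)) * (c * sqrt (2 * ln n) * exp (p * sqrt (2 * ln n) - \<delta> * ln n))) \<longlonglongrightarrow> 0"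
proof -
  have ln: "filterlim (\<lambda>n::nat. ln n) at_top sequentially" by real_asymp
  have "((\<lambda>x. (1 + sqrt (2 * x)) * (c * exp (p * sqrt (2 * x) - \<delta> * x))) \<longlongrightarrow> 0) at_top"
    using \<delta> by real_asymp
  from this ln show "(\<lambda>n::nat. (1 + sqrt (2 * ln n)) * (c * exp (p * sqrt (2 * ln n) - \<delta> * ln n))) \<longlonglongrightarrow> 0"
    by (rule filterlim_compose)
  have "((\<lambda>x. (1 + sqrt (2 * x)) * (c * sqrt (2 * x) * exp (p * sqrt (2 * x) - \<delta> * x))) \<longlongrightarrow> 0) at_top"
    using \<delta> by real_asymp
  from this ln show "(\<lambda>n::nat. (1 + sqrt (2 * ln n)) * (c * sqrt (2 * ln n) * exp (p * sqrt (2 * ln n) - \<delta> * ln n))) \<longlonglongrightarrow> 0"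
    by (rule filterlim_compose)
qed

lemma powr_dominates_ln:
  fixes \<delta> \<nu> c :: real
  assumes "0 < \<delta>" "0 < \<nu>" "0 < c"
  shows "filterlim (\<lambda>n::nat. real n powr \<delta> * (c * sqrt (2 * ln n) powr - \<nu>)) at_top sequentially"
  using assms by real_asymp

section \<open>The three tail regimes\<close>

context
  fixes G :: "real measure" and g :: "real \<Rightarrow> real"
    and Gn :: "nat \<Rightarrow> real measure" and \<sigma> :: "nat \<Rightarrow> real"
  assumes g_meas: "g \<in> borel_measurable borel"
    and g_nonneg: "\<And>\<theta>. 0 \<le> g \<theta>"
    and G_density: "G = density lborel (\<lambda>\<theta>. ennreal (g \<theta>))"
    and G_prob: "prob_space G"
    and Gn_distr: "\<And>n. real_distribution (Gn n)"
    and \<sigma>_pos: "\<And>n. 0 < \<sigma> n"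
    and Gn_scale: "\<And>n \<mu>. cdf (Gn n) \<mu> = cdf G (\<mu> / \<sigma> n)"
begin

lemmas Gn_tail_ge = scaled_tail_ge[OF g_meas g_nonneg G_density G_prob Gn_distr \<sigma>_pos Gn_scale]
lemmas Gn_powr_tail_le = scaled_powr_tail_le[OF g_meas g_nonneg G_density G_prob Gn_distr \<sigma>_pos Gn_scale]
lemmas Gn_tail_ratio_le = tail_ratio_le_gaussian[OF g_meas g_nonneg G_density G_prob Gn_distr \<sigma>_pos Gn_scale]

subsection \<open>Polynomial tails\<close>

context
  fixes \<nu> \<rho> :: real
  assumes \<nu>: "0 < \<nu>" and g_theta: "g \<in> \<Theta>(\<lambda>\<theta>. \<theta> powr (- \<nu> - 1))"
    and g_left: "(\<lambda>\<theta>. g (- \<theta>)) \<in> O(\<lambda>\<theta>. \<theta> powr (- \<nu> - 1))"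
    and \<sigma>_lim: "(\<lambda>n. \<sigma> n / real n powr \<rho>) \<longlonglongrightarrow> 1"
    and \<rho>: "- (1 / (2 * \<nu>)) < \<rho>" "\<rho> \<le> 0"
begin

lemma \<sigma>_bounds: "\<forall>\<^sub>F n in sequentially. real n powr \<rho> / 2 \<le> \<sigma> n \<and> \<sigma> n \<le> 2 * real n powr \<rho> \<and> real n powr \<rho> \<le> 1"
proof -
  have "\<forall>\<^sub>F n in sequentially. 1 / 2 < \<sigma> n / real n powr \<rho>"
    using \<sigma>_lim by (rule order_tendstoD) simp
  moreover have "\<forall>\<^sub>F n in sequentially. \<sigma> n / real n powr \<rho> < 2"
    using \<sigma>_lim by (rule order_tendstoD) simp
  ultimately show ?thesis using eventually_ge_at_top[of 1]
  proof eventually_elim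
    case (elim n)
    then have "0 < real n powr \<rho>" by simp
    moreover have "real n powr \<rho> \<le> 1" using elim \<rho>(2) powr_mono[of \<rho> 0 "real n"] by simp
    ultimately show ?case using elim by (simp add: field_simps)
  qed
qed

text \<open>The mean itself is asked to exceed t, so m = t: under a polynomial tail this has
  probability of order (t / \<sigma> n)^(-\<nu>), which is n^(\<nu> * \<rho>) up to logarithms, and
  no help from the noise is needed.\<close>

lemma polynomial_tendsto_1:
  assumes "0 \<le> \<beta>" "\<beta> < \<nu> * \<rho> + 1"
  shows "(\<lambda>n. tv_dist (H0 n) (H1 Gn \<beta> n)) \<longlonglongrightarrow> 1"
proof -
  have "g \<in> \<Omega>(\<lambda>\<theta>. \<theta> powr (- \<nu> - 1))" using g_theta by (simp add: bigtheta_def)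
  then obtain c T where c: "0 < c" "1 \<le> T" "\<And>\<theta>. T \<le> \<theta> \<Longrightarrow> c * \<theta> powr (- \<nu> - 1) \<le> g \<theta>"
    by (rule lower_boundE) (use g_nonneg in auto)
  let ?t = "\<lambda>n::nat. sqrt (2 * ln n)"
  \<comment> \<open>The mass of the window from y to 2 y with y = t / \<sigma> n, on which g is at
    least c * (2 y)^(-\<nu> - 1).\<close>
  define p where "p n = c * (2 * (?t n / \<sigma> n)) powr (- \<nu> - 1) * (?t n / \<sigma> n)" for n
  \<comment> \<open>The first power of 2 comes from the right end of the window, the second from
    \<sigma> n >= n^\<rho> / 2, and the density at 1 from the noise bound with t - m = 0.\<close>
  define c' where "c' = c * 2 powr (- \<nu> - 1) * 2 powr (- \<nu>) * std_normal_density 1"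
  have c': "0 < c'" using c(1) normal_density_pos[of 1 0 1] by (simp add: c'_def)
  have large: "\<forall>\<^sub>F n in sequentially. 2 * T \<le> ?t n"
  proof -
    have "filterlim ?t at_top sequentially" by real_asymp
    then show ?thesis by (simp add: filterlim_at_top)
  qed
  show ?thesis
  proof (rule tv_dist_tendsto_1[where m = ?t and c = p, OF Gn_distr assms(1)])
    show "\<forall>\<^sub>F n in sequentially. p n \<le> measure (Gn n) {?t n<..}"
      using large \<sigma>_bounds
    proof eventually_elim
      case (elim n)
      define y where "y = ?t n / \<sigma> n"
      have "0 \<le> ?t n" using elim c(2) by linarith
      then have "?t n / 2 \<le> y" unfolding y_def using elim \<sigma>_pos[of n] by (intro divide_left_mono) auto
      then have y: "T \<le> y" "0 < y" using elim c(2) by auto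
      have "c * (2 * y) powr (- \<nu> - 1) * y \<le> measure (Gn n) {?t n<..}"
      proof (rule Gn_tail_ge)
        show "?t n \<le> \<sigma> n * y" using \<sigma>_pos[of n] by (simp add: y_def)
        fix \<theta> assume \<theta>: "y < \<theta>" "\<theta> < y + y"
        have "c * (2 * y) powr (- \<nu> - 1) \<le> c * \<theta> powr (- \<nu> - 1)"
          using \<theta> y c(1) \<nu> by (intro mult_left_mono powr_mono2') auto
        also have "\<dots> \<le> g \<theta>" using c(3) \<theta> y by simp
        finally show "c * (2 * y) powr (- \<nu> - 1) \<le> g \<theta>" .
      qed (use c(1) y in auto)
      then show ?case by (simp add: p_def y_def)
    qed
    have "\<forall>\<^sub>F n in sequentially. real n powr (\<nu> * \<rho> + 1 - \<beta>) * (c' * ?t n powr - \<nu>)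
        \<le> real n powr (1 - \<beta>) * (p n * std_normal_density (?t n - ?t n + 1))"
      using large \<sigma>_bounds eventually_ge_at_top[of 1]
    proof eventually_elim
      case (elim n)
      define y where "y = ?t n / \<sigma> n"
      have t: "0 < ?t n" using elim c(2) by linarith
      have "y \<le> 2 * ?t n * real n powr - \<rho>"
      proof -
        have "y \<le> ?t n / (real n powr \<rho> / 2)" unfolding y_def
          using elim t \<sigma>_pos[of n] by (intro divide_left_mono) auto
        then show ?thesis by (simp add: powr_minus field_simps)
      qed
      then have "(2 * ?t n * real n powr - \<rho>) powr - \<nu> \<le> y powr - \<nu>"
        using t \<sigma>_pos[of n] \<nu> by (intro powr_mono2') (auto simp: y_def)
      moreover have "(2 * ?t n * real n powr - \<rho>) powr - \<nu> = 2 powr - \<nu> * ?t n powr - \<nu> * real n powr (\<nu> * \<rho>)"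
        using t elim by (simp add: powr_mult powr_powr mult.commute)
      ultimately have y: "2 powr - \<nu> * ?t n powr - \<nu> * real n powr (\<nu> * \<rho>) \<le> y powr - \<nu>" by simp
      have "p n = c * 2 powr (- \<nu> - 1) * y powr - \<nu>"
      proof -
        have y0: "0 < y" using t \<sigma>_pos[of n] by (simp add: y_def)
        have "y powr (- \<nu> - 1) * y = y powr - \<nu>" using y0 by (simp add: powr_diff)
        moreover have "p n = c * 2 powr (- \<nu> - 1) * (y powr (- \<nu> - 1) * y)"
          unfolding p_def y_def[symmetric] using y0 by (simp add: powr_mult)
        ultimately show ?thesis by simp
      qed
      moreover have "c * 2 powr (- \<nu> - 1) * (2 powr - \<nu> * ?t n powr - \<nu> * real n powr (\<nu> * \<rho>))
          \<le> c * 2 powr (- \<nu> - 1) * y powr - \<nu>"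
        using y c(1) by (intro mult_left_mono) auto
      ultimately have "real n powr (1 - \<beta>) *
          (c * 2 powr (- \<nu> - 1) * (2 powr - \<nu> * ?t n powr - \<nu> * real n powr (\<nu> * \<rho>)) * std_normal_density 1)
          \<le> real n powr (1 - \<beta>) * (p n * std_normal_density 1)"
        by (intro mult_left_mono mult_right_mono) auto
      moreover have "real n powr (\<nu> * \<rho> + 1 - \<beta>) = real n powr (\<nu> * \<rho>) * real n powr (1 - \<beta>)"
        by (simp add: powr_add[symmetric] algebra_simps)
      ultimately show ?case by (simp add: c'_def mult_ac)
    qed
    then show "filterlim (\<lambda>n. real n powr (1 - \<beta>) * (p n * std_normal_density (?t n - ?t n + 1))) at_top sequentially"
      by (rule filterlim_at_top_mono[rotated]) (rule powr_dominates_ln, use assms \<nu> c' in auto)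
  qed simp
qed

text \<open>Equality is included because \<rho> = 0 gives the level 1, where convergence at the
  level itself is required. There n * eps * b, with eps = n^(-\<beta>), is only bounded by a
  multiple of a^(-\<nu>) for fixed \<open>a\<close>, so the cut-off is chosen from the target
  accuracy before n grows.\<close>

lemma polynomial_tendsto_0:
  assumes \<beta>: "\<nu> * \<rho> + 1 \<le> \<beta>"
  shows "(\<lambda>n. tv_dist (H0 n) (H1 Gn \<beta> n)) \<longlonglongrightarrow> 0"
proof -
  have "1 / 2 < \<nu> * \<rho> + 1" using \<rho>(1) \<nu> by (simp add: field_simps)
  with \<beta> have \<beta>': "1 / 2 < \<beta>" "0 \<le> \<beta>" by auto
  have "g \<in> O(\<lambda>\<theta>. \<theta> powr (- \<nu> - 1))" using g_theta by (simp add: bigtheta_def)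
  from this g_left obtain C T where C: "0 < C" "1 \<le> T"
      "\<And>\<theta>. T \<le> \<bar>\<theta>\<bar> \<Longrightarrow> g \<theta> \<le> C * \<bar>\<theta>\<bar> powr (- \<nu> - 1)"
    by (rule two_sided_boundE[where N = 1]) (use g_nonneg in auto)
  define D where "D = 2 * C / \<nu> * 2 powr \<nu>"
  have D: "0 < D" using C \<nu> by (simp add: D_def)
  have "\<forall>\<^sub>F n in sequentially. tv_dist (H0 n) (H1 Gn \<beta> n) < e" if e: "0 < e" for e
  proof -
    \<comment> \<open>With the remaining terms vanishing, the bound tends to sqrt (2 \<delta>) = e /
      sqrt 2 < e.\<close>
    define \<delta> where "\<delta> = e\<^sup>2 / 4"
    have \<delta>: "0 < \<delta>" using e by (simp add: \<delta>_def)
    have "((\<lambda>a. D * a powr - \<nu>) \<longlongrightarrow> 0) at_top" using D \<nu> by real_asymp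
    then have "\<forall>\<^sub>F a in at_top. D * a powr - \<nu> < \<delta>" using \<delta> by (rule order_tendstoD)
    then obtain a where a: "2 * T \<le> a" "D * a powr - \<nu> < \<delta>"
      using eventually_at_top_linorder_ge[of _ "2 * T"] by blast
    have a0: "0 < a" using a(1) C(2) by simp
    let ?B = "\<lambda>n. sqrt (exp (4 * exp (2 * a\<^sup>2) * (real n * (real n powr - \<beta>)\<^sup>2)) - 1 + 2 * \<delta>)"
    have "?B \<longlonglongrightarrow> sqrt (exp (4 * exp (2 * a\<^sup>2) * 0) - 1 + 2 * \<delta>)"
      by (intro tendsto_intros sample_size_weight_squared_tendsto_0 \<beta>')
    moreover have "sqrt (exp (4 * exp (2 * a\<^sup>2) * 0) - 1 + 2 * \<delta>) < e"
    proof (rule real_less_lsqrt)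
      show "exp (4 * exp (2 * a\<^sup>2) * 0) - 1 + 2 * \<delta> < e\<^sup>2" using e by (simp add: \<delta>_def)
    qed (use e in auto)
    ultimately have "\<forall>\<^sub>F n in sequentially. ?B n < e" by (rule order_tendstoD(2))
    then show ?thesis using \<sigma>_bounds eventually_ge_at_top[of 1]
    proof eventually_elim
      case (elim n)
      define b where "b = 2 * C / \<nu> * (a / \<sigma> n) powr - \<nu>"
      have b0: "0 \<le> b" using C(1) \<nu> by (simp add: b_def)
      \<comment> \<open>Since \<rho> <= 0 the scales stay bounded, so a mean above \<open>a\<close>
        forces |\<theta>| above T, where the tail bound on g holds.\<close>
      have s2: "\<sigma> n \<le> 2" using elim by linarith
      have mass: "emeasure (Gn n) {\<mu>. a < \<bar>\<mu>\<bar>} \<le> ennreal b"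
        unfolding b_def
      proof (rule Gn_powr_tail_le[OF \<nu> a0])
        fix \<theta> assume "a < \<sigma> n * \<bar>\<theta>\<bar>"
        also have "\<dots> \<le> 2 * \<bar>\<theta>\<bar>" using s2 by (intro mult_right_mono) auto
        finally show "g \<theta> \<le> C * \<bar>\<theta>\<bar> powr (- \<nu> - 1)" using a(1) by (intro C(3)) simp
      qed (use C(1) in simp)
      have "b \<le> 2 * C / \<nu> * (2 powr \<nu> * real n powr (\<nu> * \<rho>) * a powr - \<nu>)"
      proof -
        have "a / (2 * real n powr \<rho>) \<le> a / \<sigma> n"
          using elim a0 \<sigma>_pos[of n] by (intro divide_left_mono) auto
        then have "(a / \<sigma> n) powr - \<nu> \<le> (a / (2 * real n powr \<rho>)) powr - \<nu>"
          using a0 elim \<nu> by (intro powr_mono2') auto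
        also have "\<dots> = 2 powr \<nu> * real n powr (\<nu> * \<rho>) * a powr - \<nu>"
          using a0 elim by (simp add: powr_divide powr_mult powr_powr powr_minus field_simps)
        finally show ?thesis unfolding b_def using C(1) \<nu> by (intro mult_left_mono) auto
      qed
      then have "real n * (real n powr - \<beta> * b) \<le> real n * (real n powr - \<beta> * (2 * C / \<nu> * (2 powr \<nu> * real n powr (\<nu> * \<rho>) * a powr - \<nu>)))"
        by (intro mult_left_mono) auto
      also have "\<dots> = real n powr (1 + - \<beta> + \<nu> * \<rho>) * (D * a powr - \<nu>)"
        unfolding powr_add using elim by (simp add: D_def)
      also have "\<dots> \<le> 1 * \<delta>"
        using a(2) D elim \<beta> powr_mono[of "1 + - \<beta> + \<nu> * \<rho>" 0 "real n"]
        by (intro mult_mono) auto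
      finally have b: "real n * (real n powr - \<beta> * b) \<le> \<delta>" by simp
      have "tv_dist (H0 n) (H1 Gn \<beta> n)
          \<le> sqrt (exp (real n * ((real n powr - \<beta>)\<^sup>2 * (4 * exp (2 * a\<^sup>2) + 2 * 0))) - 1 + 2 * real n * (real n powr - \<beta> * b))"
      \<comment> \<open>With t = -1 the condition t < |x| always holds: all large means are
        discarded, the second moment term is zero, and \<open>b\<close> is just their mass.\<close>
      proof (rule tv_dist_le[OF \<beta>'(2) _ Gn_distr, where t = "- 1"])
        show "(\<integral>\<^sup>+x. tail_ratio (Gn n) a x * indicator {x. - 1 < \<bar>x\<bar>} x \<partial>gauss 0) \<le> ennreal b"
        proof -
          have "{x::real. - 1 < \<bar>x\<bar>} = UNIV" by (auto intro: less_le_trans[of _ 0])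
          then show ?thesis using mass nn_integral_tail_ratio[OF Gn_distr, of n a] by simp
        qed
        have "{x::real. \<bar>x\<bar> \<le> - 1} = {}" by auto
        then show "(\<integral>\<^sup>+x. (tail_ratio (Gn n) a x)\<^sup>2 * indicator {x. \<bar>x\<bar> \<le> - 1} x \<partial>gauss 0) \<le> ennreal 0"
          by simp
      qed (use elim b0 a0 in auto)
      also have "\<dots> \<le> ?B n" using b by (simp add: algebra_simps)
      also have "\<dots> < e" using elim by simp
      finally show ?case .
    qed
  qed
  moreover have "\<forall>\<^sub>F n in sequentially. 0 \<le> tv_dist (H0 n) (H1 Gn \<beta> n)"
    using eventually_ge_at_top[of 1] by eventually_elim (intro tv_dist_H0_H1_nonneg \<beta>' Gn_distr)
  ultimately show ?thesis
    by (intro order_tendstoI) (auto elim: eventually_mono)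
qed

lemma critical_level_polynomial: "critical_sparsity_level Gn (\<nu> * \<rho> + 1)"
proof (rule critical_sparsity_levelI)
  have "1 / 2 < \<nu> * \<rho> + 1" using \<rho>(1) \<nu> by (simp add: field_simps)
  then show "0 < \<nu> * \<rho> + 1" by simp
  show "\<nu> * \<rho> + 1 \<le> 1" using \<rho>(2) \<nu> by (simp add: mult_nonneg_nonpos)
  then show "(\<lambda>n. tv_dist (H0 n) (H1 Gn 1 n)) \<longlonglongrightarrow> 0" by (rule polynomial_tendsto_0)
  show "(\<lambda>n. tv_dist (H0 n) (H1 Gn \<beta> n)) \<longlonglongrightarrow> 0" if "\<nu> * \<rho> + 1 < \<beta>" for \<beta>
    using that by (intro polynomial_tendsto_0) simp
qed (rule polynomial_tendsto_1)

end

subsection \<open>Exponential tails\<close>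

context
  fixes r :: real
  assumes g_theta: "g \<in> \<Theta>(\<lambda>\<theta>. exp (- \<theta>))"
    and g_left: "(\<lambda>\<theta>. g (- \<theta>)) \<in> O(\<lambda>\<theta>. exp (- \<theta>))"
    and \<sigma>_eq: "\<forall>n\<ge>2. \<sigma> n = r * (2 * ln (real n)) powr (- 1 / 2)"
    and r: "sqrt 2 / (sqrt 2 - 1) < r"
begin

text \<open>Rationalising gives sqrt 2 / (sqrt 2 - 1) = 2 + sqrt 2, whose reciprocal is 1 - sqrt 2 /
  2; hence 1 - 1 / r > sqrt 2 / 2. The cruder r >= 3 is used to compare t with t / r.\<close>

lemma r_bounds: "3 \<le> r" "1 / 2 < (1 - 1 / r)\<^sup>2"
proof -
  have "0 < sqrt 2 - (1::real)" by simp
  moreover have "sqrt 2 = (2 + sqrt 2) * (sqrt 2 - (1::real))" by (simp add: algebra_simps)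
  ultimately have eq: "sqrt 2 / (sqrt 2 - 1) = 2 + sqrt (2::real)" by (simp add: divide_eq_eq)
  have s1: "1 \<le> sqrt (2::real)" by simp
  with r eq show "3 \<le> r" by linarith
  have "0 < r * (2 + sqrt 2)" using r eq s1 by (intro mult_pos_pos) linarith+
  then have "1 / r < 1 / (2 + sqrt 2)" using r eq by (intro divide_strict_left_mono) auto
  also have "\<dots> = 1 - sqrt 2 / 2"
  proof -
    have "(1 - sqrt 2 / 2) * (2 + sqrt 2) = (1::real)" by (simp add: algebra_simps)
    moreover have "2 + sqrt 2 \<noteq> (0::real)" using s1 by linarith
    ultimately show ?thesis by (metis nonzero_eq_divide_eq)
  qed
  finally have "sqrt 2 / 2 < 1 - 1 / r" by simp
  then have "(sqrt 2 / 2)\<^sup>2 < (1 - 1 / r)\<^sup>2" by (intro power_strict_mono) auto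
  then show "1 / 2 < (1 - 1 / r)\<^sup>2" by (simp add: power_divide)
qed

lemma \<sigma>_exponential: "2 \<le> n \<Longrightarrow> \<sigma> n = r / sqrt (2 * ln n)"
proof -
  assume n: "2 \<le> n"
  then have "0 < 2 * ln (real n)" by simp
  then have "(2 * ln (real n)) powr (- 1 / 2) = 1 / sqrt (2 * ln n)"
    using powr_minus_divide[of "2 * ln (real n)" "1 / 2"] by (simp add: powr_half_sqrt)
  then show ?thesis using \<sigma>_eq n by simp
qed

text \<open>As \<sigma> n = r / t, a mean m costs m * t / r in the exponent. The sum m * t / r + (t
  - m)^2 / 2 is smallest at m = (1 - 1 / r) * t, where it equals (1 - (1 - 1 / r)^2) * ln n.\<close>

lemma exponential_tendsto_1:
  assumes "0 \<le> \<beta>" "\<beta> < (1 - 1 / r)\<^sup>2"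
  shows "(\<lambda>n. tv_dist (H0 n) (H1 Gn \<beta> n)) \<longlonglongrightarrow> 1"
proof -
  have "g \<in> \<Omega>(\<lambda>\<theta>. exp (- \<theta>))" using g_theta by (simp add: bigtheta_def)
  then obtain c T where c: "0 < c" "0 \<le> T" "\<And>\<theta>. T \<le> \<theta> \<Longrightarrow> c * exp (- \<theta>) \<le> g \<theta>"
    by (rule lower_boundE) (use g_nonneg in auto)
  let ?t = "\<lambda>n::nat. sqrt (2 * ln n)"
  let ?m = "\<lambda>n. (1 - 1 / r) * ?t n"
  \<comment> \<open>This is m / \<sigma> n, with t^2 replaced by 2 ln n.\<close>
  define y where "y n = (1 - 1 / r) * (2 * ln (real n)) / r" for n :: nat
  define p where "p n = c * exp (- (y n + 1)) * 1" for n
  define \<delta> where "\<delta> = (1 - 1 / r)\<^sup>2 - \<beta>"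
  have r0: "0 < r" "0 < 1 - 1 / r" using r_bounds(1) by auto
  have "filterlim y at_top sequentially"
  proof -
    define k where "k = (1 - 1 / r) * 2 / r"
    have "0 < k" unfolding k_def using r0 by (intro divide_pos_pos mult_pos_pos) auto
    then have "filterlim (\<lambda>n::nat. k * ln n) at_top sequentially" by real_asymp
    moreover have "y = (\<lambda>n. k * ln (real n))"
      unfolding y_def[abs_def] k_def by (simp add: fun_eq_iff mult.assoc)
    ultimately show ?thesis by simp
  qed
  then have y: "\<forall>\<^sub>F n in sequentially. T \<le> y n" by (simp add: filterlim_at_top)
  show ?thesis
  proof (rule tv_dist_tendsto_1[where m = ?m and c = p, OF Gn_distr assms(1)])
    show "\<forall>\<^sub>F n in sequentially. ?m n \<le> ?t n"
      using eventually_ge_at_top[of 1]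
    proof eventually_elim
      case (elim n)
      then show ?case using r0 by (intro mult_left_le_one_le) auto
    qed
    show "\<forall>\<^sub>F n in sequentially. p n \<le> measure (Gn n) {?m n<..}"
      using y eventually_ge_at_top[of 2]
    proof eventually_elim
      case (elim n)
      show ?case unfolding p_def
      proof (rule Gn_tail_ge)
        have "0 < ?t n" "?t n * ?t n = 2 * ln n" using elim by simp_all
        then have "\<sigma> n * y n = ?m n"
          unfolding \<sigma>_exponential[OF elim(2)] y_def using r0(1) by (simp add: field_simps)
        then show "?m n \<le> \<sigma> n * y n" by simp
        fix \<theta> assume \<theta>: "y n < \<theta>" "\<theta> < y n + 1"
        then have "c * exp (- (y n + 1)) \<le> c * exp (- \<theta>)" using c(1) by simp
        also have "\<dots> \<le> g \<theta>" using \<theta> elim by (intro c(3)) simp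
        finally show "c * exp (- (y n + 1)) \<le> g \<theta>" .
      qed (use c(1) in auto)
    qed
    \<comment> \<open>The surplus exponent is \<delta>. The term - t / r is the cross term of (t / r
      + 1)^2 / 2, and - 3 / 2 collects 1 from the unit window of g and 1 / 2 from that of the
      noise.\<close>
    have ev: "\<forall>\<^sub>F n in sequentially.
        c / sqrt (2 * pi) * exp (\<delta> * ln n + (- 1 / r) * ?t n + (- 3 / 2))
        = real n powr (1 - \<beta>) * (p n * std_normal_density (?t n - ?m n + 1))"
      using eventually_ge_at_top[of 2]
    proof eventually_elim
      case (elim n)
      have t2: "(?t n)\<^sup>2 = 2 * ln n" using elim by simp
      have "?t n - ?m n + 1 = ?t n / r + 1" by (simp add: algebra_simps)
      then have "(?t n - ?m n + 1)\<^sup>2 = (?t n)\<^sup>2 / r\<^sup>2 + 2 * (?t n / r) + 1"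
        by (simp add: power2_sum power_divide)
      then have sq: "(?t n - ?m n + 1)\<^sup>2 / 2 = ln n / r\<^sup>2 + ?t n / r + 1 / 2" unfolding t2 by (simp add: mult.commute)
      have "\<delta> * ln n + (- 1 / r) * ?t n + (- 3 / 2)
          = (1 - \<beta>) * ln n + (- (y n + 1)) + (- ((?t n - ?m n + 1)\<^sup>2 / 2))"
        unfolding sq y_def \<delta>_def using r0(1) by (simp add: field_simps power2_eq_square)
      then have "exp (\<delta> * ln n + (- 1 / r) * ?t n + (- 3 / 2))
          = exp ((1 - \<beta>) * ln n) * exp (- (y n + 1)) * exp (- ((?t n - ?m n + 1)\<^sup>2 / 2))"
        by (simp only: exp_add)
      also have "exp ((1 - \<beta>) * ln n) = real n powr (1 - \<beta>)" using elim by (simp add: powr_def)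
      finally show ?case by (simp add: p_def std_normal_density_def)
    qed
    have lim: "filterlim (\<lambda>n::nat. c / sqrt (2 * pi) * exp (\<delta> * ln n + (- 1 / r) * ?t n + (- 3 / 2))) at_top sequentially"
      using assms c(1) by (intro exp_ln_dominates) (auto simp: \<delta>_def)
    show "filterlim (\<lambda>n. real n powr (1 - \<beta>) * (p n * std_normal_density (?t n - ?m n + 1))) at_top sequentially"
      by (rule iffD1[OF filterlim_cong[OF refl refl ev] lim])
  qed
qed

text \<open>Since |\<theta>| = \<sigma> n * |\<theta>| * (t / r), the factor exp (- |\<theta>|) acts
  as a shift of |x| by t / r. Completing the square gives the bound exp (z^2 / 2), which at |x| = t
  is n^((1 - 1 / r)^2).\<close>

lemma exponential_tendsto_0:
  assumes \<beta>: "(1 - 1 / r)\<^sup>2 < \<beta>"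
  shows "(\<lambda>n. tv_dist (H0 n) (H1 Gn \<beta> n)) \<longlonglongrightarrow> 0"
proof -
  have \<beta>': "1 / 2 < \<beta>" using \<beta> r_bounds(2) by simp
  have r0: "0 < r" using r_bounds(1) by simp
  have "g \<in> O(\<lambda>\<theta>. exp (- \<theta>))" using g_theta by (simp add: bigtheta_def)
  from this g_left obtain C T where C: "0 < C" "0 \<le> T"
      "\<And>\<theta>. T \<le> \<bar>\<theta>\<bar> \<Longrightarrow> g \<theta> \<le> C * exp (- \<bar>\<theta>\<bar>)"
    by (rule two_sided_boundE[where N = 0]) (use g_nonneg in auto)
  let ?t = "\<lambda>n::nat. sqrt (2 * ln n)"
  \<comment> \<open>The positive part dominates |x| - t / r and makes W vanish for |x| <= t / r;
    without it the square would grow again as |x| decreases.\<close>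
  define z where "z n y = max 0 (y - ?t n / r)" for n y
  define W where "W n y = (z n y)\<^sup>2 / 2" for n y
  define K where "K n = 2 * C * sqrt (2 * pi) / \<sigma> n" for n
  have large: "\<forall>\<^sub>F n in sequentially. r \<le> ?t n"
  proof -
    have "filterlim ?t at_top sequentially" by real_asymp
    then show ?thesis by (simp add: filterlim_at_top)
  qed
  have z_t: "z n (?t n) = ?t n * (1 - 1 / r)" if "1 \<le> n" for n
  proof -
    have "0 \<le> ?t n * (1 - 1 / r)" using r_bounds(1) that by (intro mult_nonneg_nonneg) auto
    then show ?thesis by (simp add: z_def algebra_simps)
  qed
  show ?thesis
  proof (rule tv_dist_tendsto_0_of_pointwise_bound[where a = T and K = K and W = W, OF Gn_distr \<beta>' C(2)])
    show "\<forall>\<^sub>F n in sequentially. 0 \<le> K n \<and> (\<forall>x. tail_ratio (Gn n) T x \<le> ennreal (K n * exp (W n \<bar>x\<bar>)))"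
      using large eventually_ge_at_top[of 2]
    proof eventually_elim
      case (elim n)
      have \<sigma>: "\<sigma> n = r / ?t n" by (rule \<sigma>_exponential[OF elim(2)])
      \<comment> \<open>With \<sigma> n <= 1, a mean above T forces |\<theta>| > T, so T itself can
        serve as the cut-off \<open>a\<close>.\<close>
      have \<sigma>1: "\<sigma> n \<le> 1" unfolding \<sigma> using elim r0 by (simp add: divide_le_eq)
      have "tail_ratio (Gn n) T x \<le> ennreal (K n * exp (W n \<bar>x\<bar>))" for x
        unfolding K_def W_def
      proof (rule Gn_tail_ratio_le)
        fix \<theta> assume \<theta>: "T < \<sigma> n * \<bar>\<theta>\<bar>"
        also have "\<dots> \<le> 1 * \<bar>\<theta>\<bar>" using \<sigma>1 by (intro mult_right_mono) auto
        finally have "g \<theta> \<le> C * exp (- \<bar>\<theta>\<bar>)" by (intro C(3)) simp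
        then have "g \<theta> * exp (\<sigma> n * \<theta> * x - (\<sigma> n * \<theta>)\<^sup>2 / 2)
            \<le> C * exp (- \<bar>\<theta>\<bar>) * exp (\<sigma> n * \<theta> * x - (\<sigma> n * \<theta>)\<^sup>2 / 2)"
          by (intro mult_right_mono) auto
        also have "\<dots> = C * exp (- \<bar>\<theta>\<bar> + (\<sigma> n * \<theta> * x - (\<sigma> n * \<theta>)\<^sup>2 / 2))"
          by (simp only: exp_add mult.assoc)
        also have "\<dots> \<le> C * exp ((z n \<bar>x\<bar>)\<^sup>2 / 2 - (\<sigma> n * \<bar>\<theta>\<bar> - z n \<bar>x\<bar>)\<^sup>2 / 2)"
        proof -
          have "\<theta> * x \<le> \<bar>\<theta>\<bar> * \<bar>x\<bar>" unfolding abs_mult[symmetric] by simp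
          then have "\<sigma> n * (\<theta> * x) \<le> \<sigma> n * (\<bar>\<theta>\<bar> * \<bar>x\<bar>)" using \<sigma>_pos[of n] by (intro mult_left_mono) auto
          moreover have "\<sigma> n * \<bar>\<theta>\<bar> * (\<bar>x\<bar> - ?t n / r) \<le> \<sigma> n * \<bar>\<theta>\<bar> * z n \<bar>x\<bar>"
            using \<sigma>_pos[of n] by (intro mult_left_mono) (auto simp: z_def)
          moreover have "\<sigma> n * \<bar>\<theta>\<bar> * (?t n / r) = \<bar>\<theta>\<bar>"
            using elim r0 by (simp add: \<sigma>)
          moreover have "(z n \<bar>x\<bar>)\<^sup>2 / 2 - (\<sigma> n * \<bar>\<theta>\<bar> - z n \<bar>x\<bar>)\<^sup>2 / 2 = \<sigma> n * \<bar>\<theta>\<bar> * z n \<bar>x\<bar> - (\<sigma> n * \<theta>)\<^sup>2 / 2"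
            by (simp add: power2_diff power_mult_distrib field_simps)
          ultimately have "- \<bar>\<theta>\<bar> + (\<sigma> n * \<theta> * x - (\<sigma> n * \<theta>)\<^sup>2 / 2)
              \<le> (z n \<bar>x\<bar>)\<^sup>2 / 2 - (\<sigma> n * \<bar>\<theta>\<bar> - z n \<bar>x\<bar>)\<^sup>2 / 2"
            by (simp add: right_diff_distrib mult.assoc)
          then show ?thesis using C(1) by simp
        qed
        finally show "g \<theta> * exp (\<sigma> n * \<theta> * x - (\<sigma> n * \<theta>)\<^sup>2 / 2)
            \<le> C * exp ((z n \<bar>x\<bar>)\<^sup>2 / 2 - (\<sigma> n * \<bar>\<theta>\<bar> - z n \<bar>x\<bar>)\<^sup>2 / 2)" .
      qed (use C(1) \<sigma>_pos[of n] in auto)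
      moreover have "0 \<le> K n" using C(1) \<sigma>_pos[of n] by (simp add: K_def)
      ultimately show ?case by simp
    qed
    show "\<forall>\<^sub>F n in sequentially. \<forall>y. 0 \<le> y \<longrightarrow> y \<le> ?t n \<longrightarrow> 2 * W n y - y\<^sup>2 / 2 \<le> 2 * W n (?t n) - (?t n)\<^sup>2 / 2"
      using eventually_ge_at_top[of 2]
    proof (eventually_elim, intro allI impI)
      fix n :: nat and y assume n: "2 \<le> n" and y: "0 \<le> y" "y \<le> ?t n"
      define s where "s = ?t n / r"
      have s: "0 < s" "?t n = r * s" using n r0 by (simp_all add: s_def)
      have rhs: "2 * W n (?t n) - (?t n)\<^sup>2 / 2 = (?t n - s)\<^sup>2 - (?t n)\<^sup>2 / 2"
      proof -
        have "z n (?t n) = ?t n - s" using z_t[of n] n by (simp add: s_def right_diff_distrib)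
        then show ?thesis by (simp add: W_def)
      qed
      show "2 * W n y - y\<^sup>2 / 2 \<le> 2 * W n (?t n) - (?t n)\<^sup>2 / 2"
      \<comment> \<open>For y <= s the left side is at most 0, and the right side is not negative
        because (1 - 1 / r)^2 > 1/2. For y > s the difference of the sides factors as (t - y) * ((t
        + y) / 2 - 2 s), and t >= 3 s.\<close>
      proof (cases "y \<le> s")
        case True
        have "(?t n)\<^sup>2 * (1 / 2) \<le> (?t n)\<^sup>2 * (1 - 1 / r)\<^sup>2"
          using r_bounds(2) by (intro mult_left_mono) auto
        also have "\<dots> = (?t n - s)\<^sup>2"
          by (simp add: s_def power_mult_distrib[symmetric] algebra_simps)
        finally have "0 \<le> 2 * W n (?t n) - (?t n)\<^sup>2 / 2" unfolding rhs by simp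
        moreover have "2 * W n y - y\<^sup>2 / 2 \<le> 0" using True by (simp add: W_def z_def s_def)
        ultimately show ?thesis by simp
      next
        case False
        have "3 * s \<le> ?t n" unfolding s(2) using r_bounds(1) s(1) by (intro mult_right_mono) auto
        moreover have "0 \<le> (u + y) / 2 - 2 * s" if "3 * s \<le> u" for u
          using that False by (simp add: field_simps)
        ultimately have "0 \<le> (?t n + y) / 2 - 2 * s" by blast
        then have "0 \<le> (?t n - y) * ((?t n + y) / 2 - 2 * s)"
          using y(2) by (intro mult_nonneg_nonneg) auto
        then have "(y - s)\<^sup>2 - y\<^sup>2 / 2 \<le> (?t n - s)\<^sup>2 - (?t n)\<^sup>2 / 2"
          unfolding power2_eq_square by (simp add: field_simps)
        then show ?thesis unfolding rhs using False by (simp add: W_def z_def s_def)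
      qed
    qed
    show "\<forall>\<^sub>F n in sequentially. \<forall>y. ?t n \<le> y \<longrightarrow> W n y - y\<^sup>2 / 2 \<le> W n (?t n) - (?t n)\<^sup>2 / 2 - (y - ?t n)"
      using large eventually_ge_at_top[of 2]
    proof (eventually_elim, intro allI impI)
      fix n :: nat and y assume n: "r \<le> ?t n" "2 \<le> n" and y: "?t n \<le> y"
      define s where "s = ?t n / r"
      have s: "1 \<le> s" using n r0 by (simp add: s_def)
      have "s \<le> ?t n"
        unfolding s_def using n r_bounds(1) by (simp add: divide_le_eq)
      then have eq: "W n y = (y - s)\<^sup>2 / 2" "W n (?t n) = (?t n - s)\<^sup>2 / 2"
        using y by (simp_all add: W_def z_def s_def)
      \<comment> \<open>Beyond s the function W y - y^2 / 2 is affine with slope - s, so s >= 1 is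
        exactly the required decay.\<close>
      have "0 \<le> (s - 1) * (y - ?t n)" using s y by simp
      then show "W n y - y\<^sup>2 / 2 \<le> W n (?t n) - (?t n)\<^sup>2 / 2 - (y - ?t n)"
        unfolding eq power2_eq_square by (simp add: field_simps)
    qed
    define \<delta> where "\<delta> = \<beta> - (1 - 1 / r)\<^sup>2"
    let ?c = "2 * C * sqrt (2 * pi) / r"
    have "\<forall>\<^sub>F n in sequentially. (1 + ?t n) * (?c * ?t n * exp (0 * ?t n - \<delta> * ln n))
        = (1 + ?t n) * (K n * exp (W n (?t n)) * real n powr - \<beta>)"
      using eventually_ge_at_top[of 2]
    proof eventually_elim
      case (elim n)
      have t2: "(?t n)\<^sup>2 = 2 * ln n" using elim by simp
      have W: "W n (?t n) = ln n * (1 - 1 / r)\<^sup>2"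
        using z_t[of n] elim by (simp add: W_def power_mult_distrib t2)
      have K: "K n = ?c * ?t n" by (simp add: K_def \<sigma>_exponential[OF elim])
      have "exp (W n (?t n)) * real n powr - \<beta> = exp (W n (?t n) + - \<beta> * ln n)"
        unfolding exp_add using elim by (simp add: powr_def)
      also have "W n (?t n) + - \<beta> * ln n = 0 * ?t n - \<delta> * ln n"
        by (simp add: W \<delta>_def algebra_simps)
      finally show ?case by (simp only: K mult.assoc)
    qed
    then show "(\<lambda>n. (1 + ?t n) * (K n * exp (W n (?t n)) * real n powr - \<beta>)) \<longlonglongrightarrow> 0"
      by (rule Lim_transform_eventually[rotated]) (rule exp_ln_vanishes(2), use \<beta> in \<open>simp add: \<delta>_def\<close>)
  qed
qed

lemma critical_level_exponential: "critical_sparsity_level Gn ((1 - 1 / r)\<^sup>2)"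
proof (rule critical_sparsity_levelI)
  show "0 < (1 - 1 / r)\<^sup>2" using r_bounds(2) by linarith
  have "(1 - 1 / r)\<^sup>2 < 1\<^sup>2" using r_bounds(1) by (intro power_strict_mono) auto
  then show "(1 - 1 / r)\<^sup>2 \<le> 1" "(1 - 1 / r)\<^sup>2 = 1 \<Longrightarrow> (\<lambda>n. tv_dist (H0 n) (H1 Gn 1 n)) \<longlonglongrightarrow> 0" by simp_all
qed (rule exponential_tendsto_1 exponential_tendsto_0; assumption)+

end

subsection \<open>Gaussian tails\<close>

context
  fixes \<gamma> \<gamma>' r :: real
  assumes g_theta: "g \<in> \<Theta>(\<lambda>\<theta>. exp (- ((\<theta> - \<gamma>)\<^sup>2 / 2)))"
    and g_left: "(\<lambda>\<theta>. g (- \<theta>)) \<in> O(\<lambda>\<theta>. exp (- ((\<theta> - \<gamma>')\<^sup>2 / 2)))"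
    and \<sigma>_eq: "\<forall>n. \<sigma> n = r"
    and r: "1 < r"
begin

text \<open>The cost (m / r)^2 / 2 + (t - m)^2 / 2 is smallest at m = r^2 / (r^2 + 1) * t, where it
  equals ln n / (r^2 + 1). The centre \<gamma> changes only terms of order sqrt (ln n) and
  below.\<close>

lemma gaussian_tendsto_1:
  assumes "0 \<le> \<beta>" "\<beta> < r\<^sup>2 / (r\<^sup>2 + 1)"
  shows "(\<lambda>n. tv_dist (H0 n) (H1 Gn \<beta> n)) \<longlonglongrightarrow> 1"
proof -
  have "g \<in> \<Omega>(\<lambda>\<theta>. exp (- ((\<theta> - \<gamma>)\<^sup>2 / 2)))" using g_theta by (simp add: bigtheta_def)
  then obtain c T where c: "0 < c" "\<gamma> \<le> T" "\<And>\<theta>. T \<le> \<theta> \<Longrightarrow> c * exp (- ((\<theta> - \<gamma>)\<^sup>2 / 2)) \<le> g \<theta>"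
    by (rule lower_boundE) (use g_nonneg in auto)
  let ?t = "\<lambda>n::nat. sqrt (2 * ln n)"
  define d where "d = r\<^sup>2 + 1"
  have "1 < r\<^sup>2" using r by (simp add: one_less_power)
  then have d: "0 < d" "r\<^sup>2 < d" "1 < d" unfolding d_def by linarith+
  let ?m = "\<lambda>n. r\<^sup>2 / d * ?t n"
  define y where "y n = r / d * ?t n" for n
  define p where "p n = c * exp (- ((y n + 1 - \<gamma>)\<^sup>2 / 2)) * 1" for n
  define \<delta> where "\<delta> = r\<^sup>2 / d - \<beta>"
  \<comment> \<open>P collects the cross terms of the squares (r / d * t + 1 - \<gamma>)^2 / 2 and
    (t / d + 1)^2 / 2, and R their constants.\<close>
  define P where "P = - (r / d * (1 - \<gamma>) + 1 / d)"
  define R where "R = - ((1 - \<gamma>)\<^sup>2 / 2 + 1 / 2)"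
  have "filterlim y at_top sequentially"
  proof -
    define k where "k = r / d"
    have "0 < k" unfolding k_def using r d(1) by simp
    then have "filterlim (\<lambda>n. k * ?t n) at_top sequentially" by real_asymp
    then show ?thesis by (simp add: y_def[abs_def] k_def)
  qed
  then have y: "\<forall>\<^sub>F n in sequentially. T \<le> y n" by (simp add: filterlim_at_top)
  show ?thesis
  proof (rule tv_dist_tendsto_1[where m = ?m and c = p, OF Gn_distr assms(1)])
    show "\<forall>\<^sub>F n in sequentially. ?m n \<le> ?t n"
      using eventually_ge_at_top[of 1]
    proof eventually_elim
      case (elim n)
      then show ?case using d by (intro mult_left_le_one_le) auto
    qed
    show "\<forall>\<^sub>F n in sequentially. p n \<le> measure (Gn n) {?m n<..}"
      using y
    proof eventually_elim
      case (elim n)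
      show ?case unfolding p_def
      proof (rule Gn_tail_ge)
        show "?m n \<le> \<sigma> n * y n" using \<sigma>_eq by (simp add: y_def power2_eq_square)
        fix \<theta> assume \<theta>: "y n < \<theta>" "\<theta> < y n + 1"
        then have "(\<theta> - \<gamma>)\<^sup>2 \<le> (y n + 1 - \<gamma>)\<^sup>2" using elim c(2) by (intro power_mono) auto
        then have "c * exp (- ((y n + 1 - \<gamma>)\<^sup>2 / 2)) \<le> c * exp (- ((\<theta> - \<gamma>)\<^sup>2 / 2))" using c(1) by simp
        also have "\<dots> \<le> g \<theta>" using \<theta> elim by (intro c(3)) simp
        finally show "c * exp (- ((y n + 1 - \<gamma>)\<^sup>2 / 2)) \<le> g \<theta>" .
      qed (use c(1) in auto)
    qed
    have ev: "\<forall>\<^sub>F n in sequentially.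
        c / sqrt (2 * pi) * exp (\<delta> * ln n + P * ?t n + R)
        = real n powr (1 - \<beta>) * (p n * std_normal_density (?t n - ?m n + 1))"
      using eventually_ge_at_top[of 2]
    proof eventually_elim
      case (elim n)
      define u where "u = ?t n"
      have t2: "ln (real n) = u * u / 2" using elim by (simp add: u_def)
      have yn: "y n = r / d * u" by (simp add: y_def u_def)
      have "u - r\<^sup>2 / d * u = (d - r\<^sup>2) / d * u" using d(1) by (simp add: field_simps)
      then have m: "u - r\<^sup>2 / d * u + 1 = u / d + 1" by (simp add: d_def)
      have "(r / d)\<^sup>2 + (1 / d)\<^sup>2 = (r\<^sup>2 + 1) / d\<^sup>2"
        by (simp add: power_divide add_divide_distrib)
      also have "\<dots> = 1 / d" by (simp add: d_def power2_eq_square)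
      finally have q: "(r / d)\<^sup>2 + (1 / d)\<^sup>2 = 1 / d" .
      have rd: "r\<^sup>2 / d = 1 - 1 / d" using d(1) by (simp add: field_simps d_def)
      have expand: "(1 - \<beta>) * (u * u / 2) - ((a * u + 1 - \<gamma>)\<^sup>2 / 2) - ((e * u + 1)\<^sup>2 / 2)
          = (1 - \<beta> - (a\<^sup>2 + e\<^sup>2)) * (u * u / 2) + - (a * (1 - \<gamma>) + e) * u + R" for a e
        by (simp add: R_def power2_eq_square field_simps)
      have "(1 - \<beta>) * (u * u / 2) - ((r / d * u + 1 - \<gamma>)\<^sup>2 / 2) - ((u / d + 1)\<^sup>2 / 2)
          = (1 - \<beta> - ((r / d)\<^sup>2 + (1 / d)\<^sup>2)) * (u * u / 2) + P * u + R"
        using expand[of "r / d" "1 / d"] by (simp add: P_def)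
      also have "\<dots> = \<delta> * (u * u / 2) + P * u + R" unfolding q \<delta>_def rd by (simp add: algebra_simps)
      finally have "\<delta> * ln n + P * u + R
          = (1 - \<beta>) * ln n + (- ((y n + 1 - \<gamma>)\<^sup>2 / 2)) + (- ((u - r\<^sup>2 / d * u + 1)\<^sup>2 / 2))"
        unfolding t2 m yn by linarith
      then have "exp (\<delta> * ln n + P * u + R)
          = exp ((1 - \<beta>) * ln n) * exp (- ((y n + 1 - \<gamma>)\<^sup>2 / 2)) * exp (- ((u - r\<^sup>2 / d * u + 1)\<^sup>2 / 2))"
        by (simp only: exp_add)
      also have "exp ((1 - \<beta>) * ln n) = real n powr (1 - \<beta>)" using elim by (simp add: powr_def)
      finally show ?case unfolding u_def[symmetric] by (simp add: p_def std_normal_density_def)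
    qed
    have lim: "filterlim (\<lambda>n::nat. c / sqrt (2 * pi) * exp (\<delta> * ln n + P * ?t n + R)) at_top sequentially"
      using assms c(1) by (intro exp_ln_dominates) (auto simp: \<delta>_def d_def)
    show "filterlim (\<lambda>n. real n powr (1 - \<beta>) * (p n * std_normal_density (?t n - ?m n + 1))) at_top sequentially"
      by (rule iffD1[OF filterlim_cong[OF refl refl ev] lim])
  qed
qed

text \<open>Up to the harmless - c^2 / 2, the exponent is |\<theta>| * (c + r |x|) - d * \<theta>^2
  / 2 with d = r^2 + 1. Completing the square yields W y = (c + r y)^2 / (2 d), whose leading term
  at t is r^2 / d * ln n.\<close>

lemma gaussian_tendsto_0:
  assumes \<beta>: "r\<^sup>2 / (r\<^sup>2 + 1) < \<beta>"
  shows "(\<lambda>n. tv_dist (H0 n) (H1 Gn \<beta> n)) \<longlonglongrightarrow> 0"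
proof -
  define d where "d = r\<^sup>2 + 1"
  have r2: "1 < r\<^sup>2" using r by (simp add: one_less_power)
  have d: "0 < d" "d < 2 * r\<^sup>2" using r2 by (simp_all add: d_def)
  have half: "1 / 2 < r\<^sup>2 / d" using d by (simp add: field_simps)
  also have "r\<^sup>2 / d < \<beta>" using \<beta> by (simp add: d_def)
  finally have \<beta>': "1 / 2 < \<beta>" .
  \<comment> \<open>A common centre to the right of both given ones dominates both tails at the cost
    of a factor exp (O(t)). Its non-negativity makes the linear part of W non-decreasing.\<close>
  define c where "c = max 0 (max \<gamma> \<gamma>')"
  have c: "0 \<le> c" "\<gamma> \<le> c" "\<gamma>' \<le> c" by (auto simp: c_def)
  have shift: "(\<lambda>\<theta>. exp (- ((\<theta> - \<gamma>0)\<^sup>2 / 2))) \<in> O(\<lambda>\<theta>. exp (- ((\<theta> - c)\<^sup>2 / 2)))" if "\<gamma>0 \<le> c" for \<gamma>0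
  proof (rule landau_o.big_mono)
    show "\<forall>\<^sub>F \<theta> in at_top. norm (exp (- ((\<theta> - \<gamma>0)\<^sup>2 / 2))) \<le> norm (exp (- ((\<theta> - c)\<^sup>2 / 2)))"
      using eventually_ge_at_top[of c]
    proof eventually_elim
      case (elim \<theta>)
      then have "(\<theta> - c)\<^sup>2 \<le> (\<theta> - \<gamma>0)\<^sup>2" using that by (intro power_mono) auto
      then show ?case by simp
    qed
  qed
  have "g \<in> O(\<lambda>\<theta>. exp (- ((\<theta> - \<gamma>)\<^sup>2 / 2)))" using g_theta by (simp add: bigtheta_def)
  from landau_o.big_trans[OF this shift[OF c(2)]] landau_o.big_trans[OF g_left shift[OF c(3)]]
  obtain C T where C: "0 < C" "0 \<le> T"
      "\<And>\<theta>. T \<le> \<bar>\<theta>\<bar> \<Longrightarrow> g \<theta> \<le> C * exp (- ((\<bar>\<theta>\<bar> - c)\<^sup>2 / 2))"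
    by (rule two_sided_boundE[where N = 0]) (use g_nonneg in auto)
  let ?t = "\<lambda>n::nat. sqrt (2 * ln n)"
  define z where "z y = (c + r * y) / sqrt d" for y
  define W where "W n y = (z y)\<^sup>2 / 2" for n :: nat and y
  define K where "K n = 2 * C * sqrt (2 * pi) / sqrt d" for n :: nat
  have W_eq: "W n y = (c + r * y)\<^sup>2 / (2 * d)" for n y
    using d(1) by (simp add: W_def z_def power_divide)
  have diff: "W n y - W n x = (y - x) * (2 * c * r + r\<^sup>2 * (y + x)) / (2 * d)" for n x y
    unfolding W_eq diff_divide_distrib[symmetric] by (simp add: power2_eq_square algebra_simps)
  show ?thesis
  proof (rule tv_dist_tendsto_0_of_pointwise_bound[where a = "r * T" and K = K and W = W, OF Gn_distr \<beta>'])
    \<comment> \<open>The cut-off is r * T because \<sigma> n = r, so that larger means have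
      |\<theta>| > T.\<close>
    show "0 \<le> r * T" using r C(2) by simp
    have "tail_ratio (Gn n) (r * T) x \<le> ennreal (K n * exp (W n \<bar>x\<bar>))" for n x
      unfolding K_def W_def
    proof (rule Gn_tail_ratio_le)
      fix \<theta> assume "r * T < \<sigma> n * \<bar>\<theta>\<bar>"
      then have \<theta>: "T \<le> \<bar>\<theta>\<bar>" using \<sigma>_eq r by simp
      have \<sigma>: "\<sigma> n = r" using \<sigma>_eq by simp
      have "g \<theta> * exp (\<sigma> n * \<theta> * x - (\<sigma> n * \<theta>)\<^sup>2 / 2)
          \<le> C * exp (- ((\<bar>\<theta>\<bar> - c)\<^sup>2 / 2)) * exp (\<sigma> n * \<theta> * x - (\<sigma> n * \<theta>)\<^sup>2 / 2)"
        using C(3)[OF \<theta>] by (intro mult_right_mono) auto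
      also have "\<dots> = C * exp (- ((\<bar>\<theta>\<bar> - c)\<^sup>2 / 2) + (\<sigma> n * \<theta> * x - (\<sigma> n * \<theta>)\<^sup>2 / 2))"
        by (simp only: exp_add mult.assoc)
      also have "\<dots> \<le> C * exp ((z \<bar>x\<bar>)\<^sup>2 / 2 - (sqrt d * \<bar>\<theta>\<bar> - z \<bar>x\<bar>)\<^sup>2 / 2)"
      proof -
        have "\<theta> * x \<le> \<bar>\<theta>\<bar> * \<bar>x\<bar>" unfolding abs_mult[symmetric] by simp
        then have 1: "r * (\<theta> * x) \<le> r * (\<bar>\<theta>\<bar> * \<bar>x\<bar>)" using r by (intro mult_left_mono) auto
        have 2: "sqrt d * z \<bar>x\<bar> = c + r * \<bar>x\<bar>" using d(1) by (simp add: z_def)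
        have "(z \<bar>x\<bar>)\<^sup>2 / 2 - (sqrt d * \<bar>\<theta>\<bar> - z \<bar>x\<bar>)\<^sup>2 / 2 = \<bar>\<theta>\<bar> * (sqrt d * z \<bar>x\<bar>) - (sqrt d)\<^sup>2 * \<theta>\<^sup>2 / 2"
          by (simp add: power2_diff power_mult_distrib field_simps)
        also have "\<dots> = \<bar>\<theta>\<bar> * c + r * (\<bar>\<theta>\<bar> * \<bar>x\<bar>) - (r\<^sup>2 * \<theta>\<^sup>2 + \<theta>\<^sup>2) / 2"
          unfolding 2 using d(1) by (simp add: d_def algebra_simps)
        also have "\<dots> \<ge> - ((\<bar>\<theta>\<bar> - c)\<^sup>2 / 2) + (r * (\<theta> * x) - (r * \<theta>)\<^sup>2 / 2)"
        proof -
          have "(\<bar>\<theta>\<bar> - c)\<^sup>2 / 2 = \<theta>\<^sup>2 / 2 - \<bar>\<theta>\<bar> * c + c\<^sup>2 / 2"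
            by (simp add: power2_diff field_simps)
          moreover have "(r * \<theta>)\<^sup>2 / 2 = r\<^sup>2 * \<theta>\<^sup>2 / 2" by (simp add: power_mult_distrib)
          ultimately show ?thesis
            unfolding add_divide_distrib using 1 zero_le_power2[of c] by linarith
        qed
        finally show ?thesis using C(1) by (simp add: \<sigma> mult.assoc)
      qed
      finally show "g \<theta> * exp (\<sigma> n * \<theta> * x - (\<sigma> n * \<theta>)\<^sup>2 / 2)
          \<le> C * exp ((z \<bar>x\<bar>)\<^sup>2 / 2 - (sqrt d * \<bar>\<theta>\<bar> - z \<bar>x\<bar>)\<^sup>2 / 2)" .
    qed (use C(1) d(1) in auto)
    moreover have "0 \<le> K n" for n using C(1) d(1) by (simp add: K_def)
    ultimately show "\<forall>\<^sub>F n in sequentially. 0 \<le> K n \<and> (\<forall>x. tail_ratio (Gn n) (r * T) x \<le> ennreal (K n * exp (W n \<bar>x\<bar>)))"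
      by simp
    \<comment> \<open>Here r > 1 enters: r^2 / d > 1/2 makes 2 W grow faster than y^2 / 2.\<close>
    have W1: "2 * W n y - y\<^sup>2 / 2 \<le> 2 * W n t - t\<^sup>2 / 2" if y: "0 \<le> y" "y \<le> t" for n y t
    proof -
      have "(t - y) * ((t + y) / 2) \<le> (t - y) * ((t + y) * (r\<^sup>2 / d))"
        using mult_left_mono[of "1 / 2" "r\<^sup>2 / d" "t + y"] half y by (intro mult_left_mono) simp_all
      also have "\<dots> \<le> 2 * ((t - y) * (2 * c * r + r\<^sup>2 * (t + y)) / (2 * d))"
      proof -
        have "0 \<le> (t - y) * (2 * c * r) / d" using y c(1) r d(1) by simp
        then show ?thesis by (simp add: algebra_simps add_divide_distrib diff_divide_distrib)
      qed
      finally have "(t - y) * ((t + y) / 2) \<le> 2 * (W n t - W n y)" unfolding diff .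
      moreover have "(t - y) * ((t + y) / 2) = t\<^sup>2 / 2 - y\<^sup>2 / 2"
        by (simp add: power2_eq_square field_simps)
      ultimately show ?thesis by simp
    qed
    show "\<forall>\<^sub>F n in sequentially. \<forall>y. 0 \<le> y \<longrightarrow> y \<le> ?t n \<longrightarrow> 2 * W n y - y\<^sup>2 / 2 \<le> 2 * W n (?t n) - (?t n)\<^sup>2 / 2"
      by (intro always_eventually allI impI W1)
    \<comment> \<open>The slope of y^2 / 2 - W y is (y - c * r) / d, which is at least 1 exactly
      from y = c * r + d on.\<close>
    have W2: "W n y - y\<^sup>2 / 2 \<le> W n t - t\<^sup>2 / 2 - (y - t)" if t: "c * r + d \<le> t" "t \<le> y" for n y t
    proof -
      have "2 * c * r + r\<^sup>2 * (y + t) \<le> d * (y + t) - 2 * d"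
        using t by (simp add: d_def algebra_simps)
      then have "(y - t) * (2 * c * r + r\<^sup>2 * (y + t)) / (2 * d) \<le> (y - t) * (d * (y + t) - 2 * d) / (2 * d)"
        using t(2) d(1) by (intro divide_right_mono mult_left_mono) auto
      also have "\<dots> = y\<^sup>2 / 2 - t\<^sup>2 / 2 - (y - t)"
        using d(1) by (simp add: field_simps power2_eq_square)
      finally have "W n y - W n t \<le> y\<^sup>2 / 2 - t\<^sup>2 / 2 - (y - t)" unfolding diff .
      then show ?thesis by simp
    qed
    have "\<forall>\<^sub>F n in sequentially. c * r + d \<le> ?t n"
    proof -
      have "filterlim ?t at_top sequentially" by real_asymp
      then show ?thesis by (simp add: filterlim_at_top)
    qed
    then show "\<forall>\<^sub>F n in sequentially. \<forall>y. ?t n \<le> y \<longrightarrow> W n y - y\<^sup>2 / 2 \<le> W n (?t n) - (?t n)\<^sup>2 / 2 - (y - ?t n)"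
      by eventually_elim (intro allI impI W2)
    define \<delta> where "\<delta> = \<beta> - r\<^sup>2 / d"
    let ?c = "2 * C * sqrt (2 * pi) / sqrt d * exp (c\<^sup>2 / (2 * d))"
    have "\<forall>\<^sub>F n in sequentially. (1 + ?t n) * (?c * exp (c * r / d * ?t n - \<delta> * ln n))
        = (1 + ?t n) * (K n * exp (W n (?t n)) * real n powr - \<beta>)"
      using eventually_ge_at_top[of 2]
    proof eventually_elim
      case (elim n)
      have t2: "?t n * ?t n = 2 * ln n" using elim by simp
      have "(c + r * ?t n)\<^sup>2 = c\<^sup>2 + 2 * c * r * ?t n + r\<^sup>2 * (?t n * ?t n)"
        unfolding power2_eq_square by (simp only: algebra_simps)
      then have W: "W n (?t n) = c\<^sup>2 / (2 * d) + c * r / d * ?t n + r\<^sup>2 / d * ln n"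
        unfolding W_eq t2 by (simp add: add_divide_distrib)
      have "exp (W n (?t n)) * real n powr - \<beta> = exp (W n (?t n) + - \<beta> * ln n)"
        unfolding exp_add using elim by (simp add: powr_def)
      also have "W n (?t n) + - \<beta> * ln n = c\<^sup>2 / (2 * d) + (c * r / d * ?t n - \<delta> * ln n)"
        unfolding W \<delta>_def by (simp only: left_diff_distrib)
      finally show ?case by (simp only: K_def mult.assoc exp_add)
    qed
    then show "(\<lambda>n. (1 + ?t n) * (K n * exp (W n (?t n)) * real n powr - \<beta>)) \<longlonglongrightarrow> 0"
      by (rule Lim_transform_eventually[rotated]) (rule exp_ln_vanishes(1), use \<beta> in \<open>simp add: \<delta>_def d_def\<close>)
  qed
qed

lemma critical_level_gaussian: "critical_sparsity_level Gn (r\<^sup>2 / (r\<^sup>2 + 1))"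
proof (rule critical_sparsity_levelI)
  have "0 < r\<^sup>2" using r by simp
  then show "0 < r\<^sup>2 / (r\<^sup>2 + 1)" "r\<^sup>2 / (r\<^sup>2 + 1) \<le> 1"
    "r\<^sup>2 / (r\<^sup>2 + 1) = 1 \<Longrightarrow> (\<lambda>n. tv_dist (H0 n) (H1 Gn 1 n)) \<longlonglongrightarrow> 0"
    by (auto simp: add_pos_pos divide_eq_eq)
qed (rule gaussian_tendsto_1 gaussian_tendsto_0; assumption)+

end

end

text \<open>\<open>\<Theta>\<close> is taken at plus infinity, so the left tail of g has its own
  bound: a heavier left tail could make negative observations informative. The condition \<rho> <= 0
  keeps the level at most 1, and the formula for \<open>\<sigma>\<close> starts at n = 2 because at
  n = 1 it would give 0, against positivity.\<close>

theorem corollary1: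
  fixes G :: "real measure" and g :: "real \<Rightarrow> real"
    and Gn :: "nat \<Rightarrow> real measure" and \<sigma> :: "nat \<Rightarrow> real"
  assumes g_meas: "g \<in> borel_measurable borel"
    and g_nonneg: "\<And>\<theta>. 0 \<le> g \<theta>"
    and G_density: "G = density lborel (\<lambda>\<theta>. ennreal (g \<theta>))"
    and G_prob: "prob_space G"
    and Gn_distr: "\<And>n. real_distribution (Gn n)"
    and \<sigma>_pos: "\<And>n. 0 < \<sigma> n"
    and Gn_scale: "\<And>n \<mu>. cdf (Gn n) \<mu> = cdf G (\<mu> / \<sigma> n)"
  shows
    "(\<forall>\<nu> \<rho>. 0 < \<nu> \<longrightarrow>
        g \<in> \<Theta>(\<lambda>\<theta>. \<theta> powr (- \<nu> - 1)) \<longrightarrow>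
        (\<lambda>\<theta>. g (- \<theta>)) \<in> O(\<lambda>\<theta>. \<theta> powr (- \<nu> - 1)) \<longrightarrow>
        (\<lambda>n. \<sigma> n / real n powr \<rho>) \<longlonglongrightarrow> 1 \<longrightarrow>
        - (1 / (2 * \<nu>)) < \<rho> \<longrightarrow> \<rho> \<le> 0 \<longrightarrow>
        critical_sparsity_level Gn (\<nu> * \<rho> + 1))
     \<and>
     (\<forall>r. g \<in> \<Theta>(\<lambda>\<theta>. exp (- \<theta>)) \<longrightarrow>
        (\<lambda>\<theta>. g (- \<theta>)) \<in> O(\<lambda>\<theta>. exp (- \<theta>)) \<longrightarrow>
        (\<forall>n\<ge>2. \<sigma> n = r * (2 * ln (real n)) powr (- 1 / 2)) \<longrightarrow>
        sqrt 2 / (sqrt 2 - 1) < r \<longrightarrow>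
        critical_sparsity_level Gn ((1 - 1 / r)\<^sup>2))
     \<and>
     (\<forall>\<gamma> \<gamma>' r. g \<in> \<Theta>(\<lambda>\<theta>. exp (- ((\<theta> - \<gamma>)\<^sup>2 / 2))) \<longrightarrow>
        (\<lambda>\<theta>. g (- \<theta>)) \<in> O(\<lambda>\<theta>. exp (- ((\<theta> - \<gamma>')\<^sup>2 / 2))) \<longrightarrow>
        (\<forall>n. \<sigma> n = r) \<longrightarrow>
        1 < r \<longrightarrow>
        critical_sparsity_level Gn (r\<^sup>2 / (r\<^sup>2 + 1)))"
proof (intro conjI allI impI)
  note std = g_meas g_nonneg G_density G_prob Gn_distr \<sigma>_pos Gn_scale
  show "critical_sparsity_level Gn (\<nu> * \<rho> + 1)"
    if "0 < \<nu>" "g \<in> \<Theta>(\<lambda>\<theta>. \<theta> powr (- \<nu> - 1))" "(\<lambda>\<theta>. g (- \<theta>)) \<in> O(\<lambda>\<theta>. \<theta> powr (- \<nu> - 1))"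
      "(\<lambda>n. \<sigma> n / real n powr \<rho>) \<longlonglongrightarrow> 1" "- (1 / (2 * \<nu>)) < \<rho>" "\<rho> \<le> 0" for \<nu> \<rho>
    using that by (rule critical_level_polynomial[OF std])
  show "critical_sparsity_level Gn ((1 - 1 / r)\<^sup>2)"
    if "g \<in> \<Theta>(\<lambda>\<theta>. exp (- \<theta>))" "(\<lambda>\<theta>. g (- \<theta>)) \<in> O(\<lambda>\<theta>. exp (- \<theta>))"
      "\<forall>n\<ge>2. \<sigma> n = r * (2 * ln (real n)) powr (- 1 / 2)" "sqrt 2 / (sqrt 2 - 1) < r" for r
    using that by (rule critical_level_exponential[OF std])
  show "critical_sparsity_level Gn (r\<^sup>2 / (r\<^sup>2 + 1))"
    if "g \<in> \<Theta>(\<lambda>\<theta>. exp (- ((\<theta> - \<gamma>)\<^sup>2 / 2)))"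
      "(\<lambda>\<theta>. g (- \<theta>)) \<in> O(\<lambda>\<theta>. exp (- ((\<theta> - \<gamma>')\<^sup>2 / 2)))"
      "\<forall>n. \<sigma> n = r" "1 < r" for \<gamma> \<gamma>' r
    using that by (rule critical_level_gaussian[OF std])
qed

end
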